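(* Let $n\geq 2$, let $p>1$ be a real number that is not an even integer, and let $f\in L^{\infty}(\mathbb{S}^{n-1})$ be positive, i.e. $f\geq 0$ almost everywhere and $\int_{\mathbb{S}^{n-1}}f\,d\xi>0$. Let $H:\mathbb{R}^n\to[0,\infty)$ be defined by $$H(x)^p=\int_{\mathbb{S}^{n-1}}|\langle x,\xi\rangle|^{p}f(\xi)\,d\xi .$$ Then $H$ is the support function of a centrally symmetric convex body in $\mathbb{R}^n$ that has everywhere positive Gauss-Kronecker curvature.
   Context: $\mathbb{S}^{n-1}$ is the Euclidean unit sphere in $\mathbb{R}^n$, $\langle\cdot,\cdot\rangle$ the standard scalar product, and $d\xi$ the spherical Lebesgue measure on $\mathbb{S}^{n-1}$. A convex body is a compact convex subset of $\mathbb{R}^n$ with nonempty interior; the support function of a convex body $K$ is $h_K(x)=\max_{y\in K}\langle x,y\rangle$. That a convex body has everywhere positive Gauss-Kronecker curvature means that it is of class $C^2_+$: its boundary is a $C^2$ hypersurface whose Gauss-Kronecker curvature (the product of the principal curvatures) is positive at every boundary point. *)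

theory Defs
  imports "HOL-Analysis.Analysis"
begin

text \<open>
  The spherical Lebesgue measure is obtained from Lebesgue measure in polar coordinates: the
  measure of a Borel set \<open>A\<close> is \<open>n\<close> times the volume of the cone \<open>{r x | 0 < r \<le> 1, x \<in> A}\<close>
  over \<open>A\<close> (see \<open>emeasure_sphere_borel\<close>).  Note that \<open>sgn x = x /\<^sub>R norm x\<close> is the radial
  projection onto the sphere.
\<close>

definition sphere_borel :: "'a::euclidean_space measure" where
  "sphere_borel = scale_measure (ennreal (real DIM('a)))
     (distr (restrict_space lborel (cball 0 1 - {0})) (restrict_space borel (sphere 0 1)) sgn)"

text \<open>As with \<^const>\<open>lborel\<close> and \<^const>\<open>lebesgue\<close>, the completion admits all Lebesgue measurable
  functions.\<close>

definition sphere_lebesgue :: "'a::euclidean_space measure" where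
  "sphere_lebesgue = completion sphere_borel"

lemma space_sphere_lebesgue: "space sphere_lebesgue = sphere 0 1"
  by (simp add: sphere_lebesgue_def sphere_borel_def space_scale_measure space_restrict_space)

lemma emeasure_sphere_borel:
  fixes A :: "'a::euclidean_space set"
  assumes "A \<in> sets borel" "A \<subseteq> sphere 0 1"
  shows "emeasure sphere_borel A =
    ennreal (real DIM('a)) * emeasure lborel {r *\<^sub>R x | r x. 0 < r \<and> r \<le> 1 \<and> x \<in> A}"
proof -
  let ?B = "cball 0 1 - {0} :: 'a set"
  have meas: "sgn \<in> restrict_space lborel ?B \<rightarrow>\<^sub>M restrict_space borel (sphere 0 1)"
  proof (rule measurable_restrict_space2)
    show "sgn \<in> space (restrict_space lborel ?B) \<rightarrow> sphere 0 1"
      by (auto simp: space_restrict_space norm_sgn)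
    have "sgn \<in> borel_measurable (borel :: 'a measure)"
      unfolding sgn_div_norm [abs_def] by measurable
    then show "sgn \<in> borel_measurable (restrict_space lborel ?B)"
      by (intro measurable_restrict_space1) simp
  qed
  have A: "A \<in> sets (restrict_space borel (sphere 0 1))"
    using assms by (simp add: sets_restrict_space_iff inf.absorb1)
  have cone: "sgn -` A \<inter> ?B = {r *\<^sub>R x | r x. 0 < r \<and> r \<le> 1 \<and> x \<in> A}"
  proof (intro set_eqI iffI)
    fix y assume "y \<in> sgn -` A \<inter> ?B"
    then have "y = norm y *\<^sub>R sgn y" "0 < norm y" "norm y \<le> 1" "sgn y \<in> A"
      by (auto simp: sgn_div_norm)
    then show "y \<in> {r *\<^sub>R x | r x. 0 < r \<and> r \<le> 1 \<and> x \<in> A}" by blast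
  next
    fix y assume "y \<in> {r *\<^sub>R x | r x. 0 < r \<and> r \<le> 1 \<and> x \<in> A}"
    then obtain r x where "y = r *\<^sub>R x" "0 < r" "r \<le> 1" "x \<in> A" by blast
    moreover have "norm x = 1" using \<open>x \<in> A\<close> assms(2) by auto
    ultimately show "y \<in> sgn -` A \<inter> ?B" by (auto simp: sgn_div_norm)
  qed
  have "emeasure (restrict_space lborel ?B) (sgn -` A \<inter> ?B) = emeasure lborel (sgn -` A \<inter> ?B)"
    by (rule emeasure_restrict_space) auto
  then show ?thesis
    by (simp add: sphere_borel_def emeasure_distr [OF meas A] space_restrict_space cone)
qed

definition L_infinity :: "'a measure \<Rightarrow> ('a \<Rightarrow> real) \<Rightarrow> bool" where
  "L_infinity M f \<longleftrightarrow> f \<in> borel_measurable M \<and> (\<exists>C. AE x in M. \<bar>f x\<bar> \<le> C)"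

definition convex_body :: "'a::euclidean_space set \<Rightarrow> bool" where
  "convex_body K \<longleftrightarrow> compact K \<and> convex K \<and> interior K \<noteq> {}"

definition centrally_symmetric :: "'a::real_vector set \<Rightarrow> bool" where
  "centrally_symmetric K \<longleftrightarrow> uminus ` K = K"

text \<open>For a nonempty compact set the supremum is attained, so it is the maximum.\<close>

definition support_function :: "'a::euclidean_space set \<Rightarrow> 'a \<Rightarrow> real" where
  "support_function K x = (SUP y\<in>K. x \<bullet> y)"

definition C2_on :: "'a::euclidean_space set \<Rightarrow> ('a \<Rightarrow> real) \<Rightarrow> bool" where
  "C2_on U g \<longleftrightarrow>
     (\<exists>(g' :: 'a \<Rightarrow> 'a \<Rightarrow>\<^sub>L real) (g'' :: 'a \<Rightarrow> 'a \<Rightarrow>\<^sub>L 'a \<Rightarrow>\<^sub>L real).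
        (\<forall>x\<in>U. (g has_derivative blinfun_apply (g' x)) (at x)) \<and>
        (\<forall>x\<in>U. (g' has_derivative blinfun_apply (g'' x)) (at x)) \<and>
        continuous_on U g'')"

text \<open>An embedded hypersurface: locally a regular level set of a \<open>C\<^sup>2\<close> function.\<close>

definition C2_hypersurface :: "'a::euclidean_space set \<Rightarrow> bool" where
  "C2_hypersurface M \<longleftrightarrow>
     (\<forall>x\<in>M. \<exists>U g. open U \<and> x \<in> U \<and> C2_on U g \<and> M \<inter> U = {y \<in> U. g y = 0} \<and>
        (\<forall>y\<in>M \<inter> U. \<not> (g has_derivative (\<lambda>_. 0)) (at y)))"

text \<open>The following notions are meant for a convex body \<open>K\<close> whose boundary is a \<open>C\<^sup>2\<close>
  hypersurface, and for \<open>x \<in> frontier K\<close>.  Then \<open>K\<close> has exactly one outer unit normal at \<open>x\<close>.\<close>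

definition outer_normal :: "'a::euclidean_space set \<Rightarrow> 'a \<Rightarrow> 'a" where
  "outer_normal K x = (THE u. norm u = 1 \<and> (\<forall>y\<in>K. u \<bullet> (y - x) \<le> 0))"

definition tangent_space :: "'a::euclidean_space set \<Rightarrow> 'a \<Rightarrow> 'a set" where
  "tangent_space K x = {v. outer_normal K x \<bullet> v = 0}"

text \<open>The differential of the Gauss map \<open>outer_normal K\<close> of the boundary.  The derivative within
  the boundary is unique only on the tangent space (it is an arbitrary linear extension off it),
  so it is only ever applied to tangent vectors.\<close>

definition weingarten_map :: "'a::euclidean_space set \<Rightarrow> 'a \<Rightarrow> 'a \<Rightarrow> 'a" where
  "weingarten_map K x = frechet_derivative (outer_normal K) (at x within frontier K)"

definition principal_directions :: "'a::euclidean_space set \<Rightarrow> 'a \<Rightarrow> real \<Rightarrow> 'a set" where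
  "principal_directions K x \<kappa> = {v \<in> tangent_space K x. weingarten_map K x v = \<kappa> *\<^sub>R v}"

definition principal_curvatures :: "'a::euclidean_space set \<Rightarrow> 'a \<Rightarrow> real set" where
  "principal_curvatures K x = {\<kappa>. \<exists>v. v \<noteq> 0 \<and> v \<in> principal_directions K x \<kappa>}"

text \<open>Each principal curvature is counted with its multiplicity.  Since the Weingarten map is
  self-adjoint on the tangent space, this is the dimension of its eigenspace, and there are
  \<open>n - 1\<close> factors in total.\<close>

definition gauss_kronecker_curvature :: "'a::euclidean_space set \<Rightarrow> 'a \<Rightarrow> real" where
  "gauss_kronecker_curvature K x =
     (\<Prod>\<kappa>\<in>principal_curvatures K x. \<kappa> ^ dim (principal_directions K x \<kappa>))"

definition positive_gauss_kronecker_curvature :: "'a::euclidean_space set \<Rightarrow> bool" where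
  "positive_gauss_kronecker_curvature K \<longleftrightarrow>
     C2_hypersurface (frontier K) \<and> (\<forall>x\<in>frontier K. 0 < gauss_kronecker_curvature K x)"

end

theory Submission
  imports Defs
begin

text \<open>
  Put \<open>F = H\<^sup>p\<close>.  Differentiating under the integral sign twice gives, away from the origin,
  \<open>D\<^sup>2F(x)[v,v] = p (p - 1) \<integral> \<bar>x \<bullet> \<xi>\<bar>\<^bsup>p-2\<^esup> (v \<bullet> \<xi>)\<^sup>2 f(\<xi>) d\<xi> > 0\<close>.  For \<open>p < 2\<close> the kernel is singular,
  but since \<open>f\<close> is bounded and \<open>p - 2 > -1\<close> it is uniformly integrable for \<open>x\<close> away from \<open>0\<close>, so
  that \<open>D\<^sup>2F\<close> is still continuous.  Hence \<open>N = \<nabla>F / p\<close> is an injective \<open>C\<^sup>1\<close> map with invertible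
  derivative on the complement of \<open>0\<close>.  The boundary of the body \<open>K\<close> with support function \<open>H\<close> is
  \<open>N\<close> of the level set \<open>H = 1\<close>, and \<open>N x\<close> has outer normal \<open>x / \<bar>x\<bar>\<close>.  The inverse of \<open>N\<close> is the
  gradient of the convex conjugate of \<open>F / p\<close>, which is therefore \<open>C\<^sup>2\<close> and has the boundary as a
  level set; and the Weingarten map at \<open>N x\<close> is \<open>(DN x)\<^bsup>-1\<^esup>\<close> followed by projection to the tangent
  space, divided by \<open>\<bar>x\<bar>\<close>, so that its eigenvalues are positive.
\<close>

section \<open>Integrals over slabs of a ball\<close>

lemma nn_integral_lborel_translate:
  fixes f :: "'a::euclidean_space \<Rightarrow> ennreal"
  assumes [measurable]: "f \<in> borel_measurable borel"
  shows "(\<integral>\<^sup>+ y. f y \<partial>lborel) = (\<integral>\<^sup>+ y. f (a + y) \<partial>lborel)"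
proof -
  have "(\<integral>\<^sup>+ y. f y \<partial>lborel) = (\<integral>\<^sup>+ y. f y \<partial>distr lborel borel ((+) a))"
    by (simp add: lborel_distr_plus)
  also have "\<dots> = (\<integral>\<^sup>+ y. f (a + y) \<partial>lborel)"
    by (rule nn_integral_distr) auto
  finally show ?thesis .
qed

text \<open>The left-hand side is unchanged when the ball is translated by \<open>t\<close> in the direction of
  \<open>x\<close>.  Averaging over \<open>0 \<le> t \<le> 1\<close> turns it into an integral of \<open>h\<close> over a line.\<close>

lemma nn_integral_ball_inner_le:
  fixes x :: "'a::euclidean_space" and h :: "real \<Rightarrow> ennreal"
  assumes "x \<noteq> 0" and [measurable]: "h \<in> borel_measurable borel"
  shows "(\<integral>\<^sup>+ y. h (x \<bullet> y) * indicator (cball 0 1) y \<partial>lborel)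
    \<le> emeasure lborel (cball 0 2 :: 'a set) * (ennreal (1 / norm x) * (\<integral>\<^sup>+ s. h s \<partial>lborel))"
    (is "?L \<le> ?V * ?R")
proof -
  have [measurable]: "cball 0 r \<in> sets (borel :: 'a measure)" for r by simp
  define u where "u = x /\<^sub>R norm x"
  have nu: "norm u = 1" and xu: "x \<bullet> u = norm x"
    using assms(1) by (auto simp: u_def power2_norm_eq_inner[symmetric] power2_eq_square)
  have shift: "?L \<le> (\<integral>\<^sup>+ y. h (x \<bullet> y + norm x * t) * indicator (cball 0 2) y \<partial>lborel)"
    if t: "0 \<le> t" "t \<le> 1" for t
  proof -
    have "?L = (\<integral>\<^sup>+ y. h (x \<bullet> (t *\<^sub>R u + y)) * indicator (cball 0 1) (t *\<^sub>R u + y) \<partial>lborel)"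
      by (rule nn_integral_lborel_translate) measurable
    also have "\<dots> \<le> (\<integral>\<^sup>+ y. h (x \<bullet> y + norm x * t) * indicator (cball 0 2) y \<partial>lborel)"
    proof (rule nn_integral_mono, rule mult_mono)
      fix y
      show "h (x \<bullet> (t *\<^sub>R u + y)) \<le> h (x \<bullet> y + norm x * t)"
        by (simp add: inner_add_right xu algebra_simps)
      have "norm y \<le> 2" if "norm (t *\<^sub>R u + y) \<le> 1"
        using norm_triangle_ineq4[of "t *\<^sub>R u + y" "t *\<^sub>R u"] that t nu by simp
      then show "indicator (cball 0 1) (t *\<^sub>R u + y) \<le> (indicator (cball 0 2) y :: ennreal)"
        by (auto simp: indicator_def)
    qed auto
    finally show ?thesis .
  qed
  have "?L = (\<integral>\<^sup>+ t. ?L * indicator {0..1::real} t \<partial>lborel)"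
    by (subst nn_integral_cmult_indicator) auto
  \<comment> \<open>The cut-off in \<open>t\<close> is dropped, so that the inner integral runs over
    a whole line; the substitution \<open>s = x \<bullet> y + norm x * t\<close> then makes it the
    same for every \<open>y\<close>.\<close>
  also have "\<dots> \<le> (\<integral>\<^sup>+ t. (\<integral>\<^sup>+ y. h (x \<bullet> y + norm x * t) * indicator (cball 0 2) y \<partial>lborel) \<partial>lborel)"
  proof (rule nn_integral_mono)
    fix t :: real
    show "?L * indicator {0..1} t \<le> (\<integral>\<^sup>+ y. h (x \<bullet> y + norm x * t) * indicator (cball 0 2) y \<partial>lborel)"
      using shift[of t] by (cases "t \<in> {0..1}") simp_all
  qed
  also have "\<dots> = (\<integral>\<^sup>+ y. (\<integral>\<^sup>+ t. h (x \<bullet> y + norm x * t) * indicator (cball 0 2) y \<partial>lborel) \<partial>lborel)"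
    by (rule lborel_pair.Fubini') measurable
  also have "\<dots> = (\<integral>\<^sup>+ y. ?R * indicator (cball 0 2 :: 'a set) y \<partial>lborel)"
  proof (rule nn_integral_cong)
    fix y :: 'a
    have "ennreal (1 / norm x) * (\<integral>\<^sup>+ s. h s \<partial>lborel)
        = ennreal (1 / norm x) * (ennreal \<bar>norm x\<bar> * (\<integral>\<^sup>+ t. h (x \<bullet> y + norm x * t) \<partial>lborel))"
      using assms(1) by (subst nn_integral_real_affine[of h "norm x" "x \<bullet> y"]) auto
    also have "\<dots> = (\<integral>\<^sup>+ t. h (x \<bullet> y + norm x * t) \<partial>lborel)"
      using assms(1) by (simp add: mult.assoc[symmetric] ennreal_mult[symmetric])
    finally show "(\<integral>\<^sup>+ t. h (x \<bullet> y + norm x * t) * indicator (cball 0 2) y \<partial>lborel)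
        = ?R * indicator (cball 0 2) y"
      by (simp add: nn_integral_multc)
  qed
  also have "\<dots> = ?V * ?R"
    by (subst nn_integral_cmult_indicator) (auto simp: mult.commute)
  finally show ?thesis .
qed

section \<open>Signed powers\<close>

text \<open>Up to the factor \<open>p\<close>, the derivative of \<open>\<lambda>t. \<bar>t\<bar> powr p\<close>.\<close>

definition signed_powr :: "real \<Rightarrow> real \<Rightarrow> real" where
  "signed_powr p t = sgn t * \<bar>t\<bar> powr (p - 1)"

lemma borel_measurable_signed_powr [measurable]: "signed_powr p \<in> borel_measurable borel"
  unfolding signed_powr_def by measurable

lemma signed_powr_mult_self: "signed_powr p t * t = \<bar>t\<bar> powr p"
proof (cases "t = 0")
  case False
  have "signed_powr p t * t = \<bar>t\<bar> powr (p - 1) * \<bar>t\<bar>"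
    by (simp add: signed_powr_def abs_sgn)
  also have "\<dots> = \<bar>t\<bar> powr p"
    using False powr_add[of "\<bar>t\<bar>" "p - 1" 1] by simp
  finally show ?thesis .
qed simp

lemma signed_powr_eq: "signed_powr p t = \<bar>t\<bar> powr (p - 2) * t"
proof (cases "t = 0")
  case False
  have "\<bar>t\<bar> powr (p - 2) * t = sgn t * (\<bar>t\<bar> powr (p - 2) * \<bar>t\<bar>)"
    by (simp add: sgn_mult_abs mult.left_commute)
  also have "\<bar>t\<bar> powr (p - 2) * \<bar>t\<bar> = \<bar>t\<bar> powr (p - 1)"
    using False powr_add[of "\<bar>t\<bar>" "p - 2" 1] by simp
  finally show ?thesis by (simp add: signed_powr_def)
qed (simp add: signed_powr_def)

lemma abs_signed_powr: "\<bar>signed_powr p t\<bar> = \<bar>t\<bar> powr (p - 1)"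
  by (cases "t = 0") (simp_all add: signed_powr_def abs_mult abs_sgn_eq)

lemma has_real_derivative_signed_powr:
  assumes "t \<noteq> 0"
  shows "(signed_powr p has_real_derivative (p - 1) * \<bar>t\<bar> powr (p - 2)) (at t)"
proof -
  \<comment> \<open>On each open half-line the sign is constant, so the function is there, up to
    sign, an ordinary power of \<open>t\<close> or of \<open>- t\<close>.\<close>
  have "((\<lambda>t. sgn t * (sgn t * t) powr (p - 1)) has_real_derivative (p - 1) * \<bar>t\<bar> powr (p - 2)) (at t)"
  proof (cases "t > 0")
    case True
    have "((\<lambda>t. t powr (p - 1)) has_real_derivative (p - 1) * \<bar>t\<bar> powr (p - 2)) (at t)"
      using True by (auto intro!: derivative_eq_intros)
    then show ?thesis
      by (rule has_field_derivative_transform_within_open[where S = "{0<..}"]) (use True in auto)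
  next
    case False
    then have t: "t < 0" using assms by simp
    have "((\<lambda>t. - ((- t) powr (p - 1))) has_real_derivative (p - 1) * \<bar>t\<bar> powr (p - 2)) (at t)"
      using t by (auto intro!: derivative_eq_intros)
    then show ?thesis
      by (rule has_field_derivative_transform_within_open[where S = "{..<0}"]) (use t in auto)
  qed
  then show ?thesis
    unfolding signed_powr_def[abs_def] by (simp add: abs_sgn mult.commute)
qed

text \<open>Convexity in tangent-line form. Young's inequality for
  \<open>\<bar>a\<bar> powr (p - 1)\<close> and \<open>\<bar>b\<bar>\<close> with the conjugate
  exponents \<open>q\<close> and \<open>p\<close> yields it, including at
  \<open>a = 0\<close>.\<close>

lemma powr_tangent_le:
  assumes "p > 1"
  shows "\<bar>a\<bar> powr p + p * (signed_powr p a * (b - a)) \<le> \<bar>b\<bar> powr p"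
proof -
  define q where "q = p / (p - 1)"
  have q: "q > 1" "1 / q + 1 / p = 1" using assms by (auto simp: q_def field_simps)
  have "signed_powr p a * b \<le> \<bar>signed_powr p a\<bar> * \<bar>b\<bar>"
    by (metis abs_ge_self abs_mult)
  also have "\<dots> = \<bar>a\<bar> powr (p - 1) * \<bar>b\<bar>" by (simp add: abs_signed_powr)
  also have "\<dots> \<le> (\<bar>a\<bar> powr (p - 1)) powr q / q + \<bar>b\<bar> powr p / p"
    by (rule Youngs_inequality) (use q assms in auto)
  also have "(\<bar>a\<bar> powr (p - 1)) powr q = \<bar>a\<bar> powr p"
    using assms by (simp add: powr_powr q_def)
  finally have "p * (signed_powr p a * b) \<le> p * (\<bar>a\<bar> powr p / q + \<bar>b\<bar> powr p / p)"
    using assms by simp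
  also have "\<dots> = (p - 1) * \<bar>a\<bar> powr p + \<bar>b\<bar> powr p"
    using assms by (simp add: q_def field_simps)
  finally show ?thesis
    using signed_powr_mult_self[of p a] by (simp add: algebra_simps)
qed

lemma signed_powr_strict_mono:
  assumes "p > 1" "a < b"
  shows "signed_powr p a < signed_powr p b"
proof -
  consider "0 \<le> a" | "a < 0" "0 \<le> b" | "b < 0" by linarith
  then show ?thesis
  proof cases
    case 1
    then show ?thesis using assms powr_less_mono2[of "p - 1" a b]
      by (auto simp: signed_powr_def sgn_if)
  next
    case 2
    then show ?thesis by (auto simp: signed_powr_def sgn_if intro: order.strict_trans2[of _ 0])
  next
    case 3
    then show ?thesis using assms powr_less_mono2[of "p - 1" "- b" "- a"]
      by (auto simp: signed_powr_def sgn_if)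
  qed
qed

text \<open>The first summand serves \<open>p \<le> 2\<close>, where \<open>t powr (p - 2)\<close>
  is decreasing and can be replaced by its value at \<open>a\<close> in
  \<open>t * t powr (p - 2)\<close>. The second serves \<open>p > 2\<close>, where the mean value
  theorem applies with a bounded derivative.\<close>

lemma signed_powr_diff_le_aux:
  fixes a b p M :: real
  assumes p: "p > 1" and ab: "0 < a" "0 \<le> b" "a \<le> M" "b \<le> M"
  shows "\<bar>b powr (p - 1) - a powr (p - 1)\<bar> \<le> \<bar>b - a\<bar> * (a powr (p - 2) + p * M powr (p - 2))"
proof (cases "p \<le> 2")
  case True
  have split: "t powr (p - 1) = t * t powr (p - 2)" if "t \<ge> 0" for t :: real
    using that powr_add[of t 1 "p - 2"] by (cases "t = 0") auto
  have "\<bar>b powr (p - 1) - a powr (p - 1)\<bar> \<le> \<bar>b - a\<bar> * a powr (p - 2)"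
  proof (cases "a \<le> b")
    case ab': True
    have "b * b powr (p - 2) \<le> b * a powr (p - 2)"
      using True ab ab' by (intro mult_left_mono powr_mono2') auto
    moreover have "a powr (p - 1) \<le> b powr (p - 1)" using p ab ab' by (intro powr_mono2) auto
    ultimately show ?thesis using ab ab' by (simp add: split algebra_simps)
  next
    case ab': False
    have "b * a powr (p - 2) \<le> b * b powr (p - 2)"
    proof (cases "b = 0")
      case False
      then show ?thesis using True ab ab' by (intro mult_left_mono powr_mono2') auto
    qed simp
    moreover have "b powr (p - 1) \<le> a powr (p - 1)" using p ab ab' by (intro powr_mono2) auto
    ultimately show ?thesis using ab ab' by (simp add: split algebra_simps)
  qed
  also have "\<dots> \<le> \<bar>b - a\<bar> * (a powr (p - 2) + p * M powr (p - 2))"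
    using p by (intro mult_left_mono) auto
  finally show ?thesis .
next
  case False
  have bd: "d powr (p - 1) - c powr (p - 1) \<le> (d - c) * (p * M powr (p - 2))"
    if cd: "0 \<le> c" "c < d" "d \<le> M" for c d
  proof -
    have "\<exists>l z. c < z \<and> z < d \<and> ((\<lambda>t. t powr (p - 1)) has_real_derivative l) (at z)
        \<and> d powr (p - 1) - c powr (p - 1) = (d - c) * l"
    proof (rule MVT)
      show "continuous_on {c..d} (\<lambda>t. t powr (p - 1))"
        using p cd by (intro continuous_on_powr') auto
      show "(\<lambda>t. t powr (p - 1)) differentiable (at t)" if "c < t" "t < d" for t
        unfolding real_differentiable_def using that cd
        by (intro exI[of _ "(p - 1) * t powr (p - 1 - 1)"]) (auto intro!: derivative_eq_intros)
    qed (use cd in auto)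
    then obtain l z where z: "c < z" "z < d"
      and l: "((\<lambda>t. t powr (p - 1)) has_real_derivative l) (at z)"
      and eq: "d powr (p - 1) - c powr (p - 1) = (d - c) * l"
      by blast
    have "((\<lambda>t. t powr (p - 1)) has_real_derivative (p - 1) * z powr (p - 2)) (at z)"
      using z cd by (auto intro!: derivative_eq_intros)
    then have "l = (p - 1) * z powr (p - 2)" using l DERIV_unique by blast
    also have "\<dots> \<le> p * M powr (p - 2)"
      using False z cd by (intro mult_mono powr_mono2) auto
    finally show ?thesis unfolding eq using cd by (intro mult_left_mono) auto
  qed
  have "\<bar>b powr (p - 1) - a powr (p - 1)\<bar> \<le> \<bar>b - a\<bar> * (p * M powr (p - 2))"
  proof (cases a b rule: linorder_cases)
    case less
    then show ?thesis using bd[of a b] ab p powr_mono2[of "p - 1" a b] by auto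
  next
    case greater
    then show ?thesis using bd[of b a] ab p powr_mono2[of "p - 1" b a] by auto
  qed auto
  also have "\<dots> \<le> \<bar>b - a\<bar> * (a powr (p - 2) + p * M powr (p - 2))"
    by (intro mult_left_mono) auto
  finally show ?thesis .
qed

text \<open>The factor multiplying \<open>\<bar>b - a\<bar>\<close> is independent of
  \<open>b\<close>, so with \<open>a = x \<bullet> y\<close> it gives a common majorant for all
  difference quotients of the kernel of \<open>N\<close> at \<open>x\<close>.\<close>

lemma signed_powr_diff_le:
  assumes p: "p > 1" and ab: "a \<noteq> 0" "\<bar>a\<bar> \<le> M" "\<bar>b\<bar> \<le> M"
  shows "\<bar>signed_powr p b - signed_powr p a\<bar>
    \<le> \<bar>b - a\<bar> * (3 * (\<bar>a\<bar> powr (p - 2) + p * M powr (p - 2)))"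
proof -
  let ?c = "\<bar>a\<bar> powr (p - 2) + p * M powr (p - 2)"
  have c: "0 \<le> ?c" using p by auto
  have aux: "\<bar>\<bar>t\<bar> powr (p - 1) - \<bar>a\<bar> powr (p - 1)\<bar> \<le> \<bar>\<bar>t\<bar> - \<bar>a\<bar>\<bar> * ?c" if "\<bar>t\<bar> \<le> M" for t
    using signed_powr_diff_le_aux[of p "\<bar>a\<bar>" "\<bar>t\<bar>" M] p ab that by simp
  show ?thesis
  proof (cases "sgn a = sgn b")
    case True
    have "\<bar>signed_powr p b - signed_powr p a\<bar> = \<bar>\<bar>b\<bar> powr (p - 1) - \<bar>a\<bar> powr (p - 1)\<bar>"
      using True ab(1) by (auto simp: signed_powr_def sgn_if split: if_splits)
    also have "\<dots> \<le> \<bar>\<bar>b\<bar> - \<bar>a\<bar>\<bar> * ?c" by (rule aux) (rule ab)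
    also have "\<dots> \<le> \<bar>b - a\<bar> * (3 * ?c)"
      using c by (intro mult_mono) auto
    finally show ?thesis .
  next
    case False
    have ba: "\<bar>b - a\<bar> = \<bar>a\<bar> + \<bar>b\<bar>"
      using False ab(1) by (auto simp: sgn_if split: if_splits)
    \<comment> \<open>For different signs both powers are estimated separately: \<open>a\<close>
      against 0, then \<open>b\<close> against \<open>a\<close>. The coefficients add up to \<open>2
      * \<bar>a\<bar> + \<bar>\<bar>b\<bar> - \<bar>a\<bar>\<bar>\<close>, whence the factor
      3.\<close>
    have a: "\<bar>a\<bar> powr (p - 1) \<le> \<bar>a\<bar> * ?c"
      using aux[of 0] ab by simp
    have "\<bar>b\<bar> powr (p - 1) \<le> \<bar>a\<bar> powr (p - 1) + \<bar>\<bar>b\<bar> - \<bar>a\<bar>\<bar> * ?c"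
      using aux[OF ab(3)] by linarith
    then have "\<bar>a\<bar> powr (p - 1) + \<bar>b\<bar> powr (p - 1) \<le> (2 * \<bar>a\<bar> + \<bar>\<bar>b\<bar> - \<bar>a\<bar>\<bar>) * ?c"
      using a by (simp add: distrib_right)
    also have "\<dots> \<le> (3 * (\<bar>a\<bar> + \<bar>b\<bar>)) * ?c"
      using c by (intro mult_right_mono) auto
    finally have "\<bar>a\<bar> powr (p - 1) + \<bar>b\<bar> powr (p - 1) \<le> \<bar>b - a\<bar> * (3 * ?c)"
      by (simp only: ba mult.assoc mult.left_commute)
    then show ?thesis
      using abs_triangle_ineq4[of "signed_powr p b" "signed_powr p a"]
      by (simp add: abs_signed_powr)
  qed
qed

section \<open>Cosine transforms with exponent \<open>p\<close>\<close>

lemma nn_integral_abs_powr_le: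
  fixes a c :: real
  assumes "a > -1" "c \<ge> 0"
  shows "(\<integral>\<^sup>+ s. ennreal (\<bar>s\<bar> powr a) * indicator {-c..c} s \<partial>lborel)
    \<le> ennreal (2 * (c powr (a + 1) / (a + 1)))"
proof -
  let ?f = "\<lambda>s::real. ennreal (s powr a) * indicator {0..c} s"
  let ?I = "c powr (a + 1) / (a + 1)"
  have I: "(\<integral>\<^sup>+ s. ?f s \<partial>lborel) = ennreal ?I"
    using has_integral_powr_from_0[OF assms] by (intro nn_integral_has_integral_lebesgue') auto
  have "(\<integral>\<^sup>+ s. ennreal (\<bar>s\<bar> powr a) * indicator {-c..c} s \<partial>lborel)
      \<le> (\<integral>\<^sup>+ s. ?f s + ?f (0 + (- 1) * s) \<partial>lborel)"
    by (rule nn_integral_mono) (auto split: split_indicator)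
  also have "\<dots> = (\<integral>\<^sup>+ s. ?f s \<partial>lborel) + (\<integral>\<^sup>+ s. ?f (0 + (- 1) * s) \<partial>lborel)"
    by (rule nn_integral_add) auto
  also have "(\<integral>\<^sup>+ s. ?f (0 + (- 1) * s) \<partial>lborel) = (\<integral>\<^sup>+ s. ?f s \<partial>lborel)"
    by (subst (2) nn_integral_real_affine[where c = "-1" and t = 0]) auto
  also have "(\<integral>\<^sup>+ s. ?f s \<partial>lborel) + (\<integral>\<^sup>+ s. ?f s \<partial>lborel) = ennreal (2 * ?I)"
    unfolding I using assms by (subst ennreal_plus[symmetric]) auto
  finally show ?thesis .
qed

text \<open>The last assumption says that every slab \<open>{y. \<bar>x \<bullet> y\<bar> \<le> s}\<close> has measure \<open>O(s / norm x)\<close>,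
  in integrated form.\<close>

locale powr_transform = finite_measure M for M :: "'a::euclidean_space measure" +
  fixes p C :: real
  assumes p_gt_1: "p > 1" and C_nonneg: "C \<ge> 0"
    and sets_M [measurable_cong]: "sets M = sets borel"
    and AE_norm_le_1: "AE y in M. norm y \<le> 1"
    and emeasure_UNIV_nonzero: "emeasure M UNIV \<noteq> 0"
    and slab: "\<And>x h. \<lbrakk>x \<noteq> 0; h \<in> borel_measurable borel; \<And>a b. \<lbrakk>0 < \<bar>a\<bar>; \<bar>a\<bar> \<le> \<bar>b\<bar>\<rbrakk> \<Longrightarrow> h b \<le> h a\<rbrakk>
      \<Longrightarrow> (\<integral>\<^sup>+ y. h (x \<bullet> y) \<partial>M) \<le> ennreal (C / norm x) * (\<integral>\<^sup>+ s. h s \<partial>lborel)"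
begin

section \<open>Null hyperplanes and integrability of the Hessian kernel\<close>

lemma space_M: "space M = UNIV"
  using sets_eq_imp_space_eq[OF sets_M] by simp

text \<open>The slab bound for the indicator of \<open>{0}\<close>, whose integral over the line is
  0. This function is admissible because the monotonicity condition compares only nonzero
  arguments.\<close>

lemma AE_inner_nonzero:
  assumes "x \<noteq> 0"
  shows "AE y in M. x \<bullet> y \<noteq> 0"
proof -
  have sets: "{y. x \<bullet> y = 0} \<in> sets M"
    unfolding sets_M by (intro borel_closed closed_hyperplane)
  have "emeasure M {y. x \<bullet> y = 0} = (\<integral>\<^sup>+ y. indicator {y. x \<bullet> y = 0} y \<partial>M)"
    using sets by simp
  also have "\<dots> = (\<integral>\<^sup>+ y. indicator {0} (x \<bullet> y) \<partial>M)"
    by (simp add: indicator_def)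
  also have "\<dots> \<le> ennreal (C / norm x) * (\<integral>\<^sup>+ s. indicator {0::real} s \<partial>lborel)"
  proof (rule slab[OF assms, of "indicator {0}"])
    fix a b :: real assume "0 < \<bar>a\<bar>" "\<bar>a\<bar> \<le> \<bar>b\<bar>"
    then show "indicator {0} b \<le> (indicator {0} a :: ennreal)" by auto
  qed auto
  also have "\<dots> = 0" by simp
  finally have "emeasure M {y. x \<bullet> y = 0} = 0" by simp
  then show ?thesis
    using sets by (intro AE_I[where N = "{y. x \<bullet> y = 0}"]) auto
qed

text \<open>Near \<open>0\<close> the kernel \<open>\<bar>t\<bar> powr (p - 2)\<close> is dominated by \<open>\<bar>t\<bar> powr (q - 2)\<close>, which is
  decreasing in \<open>\<bar>t\<bar>\<close> also when \<open>p > 2\<close>.\<close>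

definition "q = min p 2"

lemma q: "1 < q" "q \<le> 2" "q \<le> p"
  using p_gt_1 by (auto simp: q_def)

text \<open>The majorant cut off to the slab of half-width \<open>e\<close>; its integral tends to 0
  with \<open>e\<close>, uniformly for \<open>x\<close> away from 0 (see
  \<open>integral_core_le\<close>).\<close>

definition "core e t = \<bar>t\<bar> powr (q - 2) * indicator {-e..e} t" for e t :: real

lemma borel_measurable_core [measurable]: "core e \<in> borel_measurable borel"
  unfolding core_def by measurable

lemma core_nonneg: "0 \<le> core e t"
  by (simp add: core_def)

text \<open>Here \<open>p > 1\<close> enters: it gives \<open>q - 2 > -1\<close>, so the line
  integral converges at 0. The value of \<open>core e\<close> at 0 is 0, as
  \<open>0 powr a = 0\<close>; the slab condition tolerates this drop.\<close>

lemma nn_integral_core_le: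
  assumes "x \<noteq> 0" "e > 0"
  shows "(\<integral>\<^sup>+ y. ennreal (core e (x \<bullet> y)) \<partial>M) \<le> ennreal (C / norm x * (2 * (e powr (q - 1) / (q - 1))))"
proof -
  have "(\<integral>\<^sup>+ y. ennreal (core e (x \<bullet> y)) \<partial>M) \<le> ennreal (C / norm x) * (\<integral>\<^sup>+ s. ennreal (core e s) \<partial>lborel)"
  proof (rule slab[OF assms(1)])
    fix a b :: real assume "0 < \<bar>a\<bar>" "\<bar>a\<bar> \<le> \<bar>b\<bar>"
    then show "ennreal (core e b) \<le> ennreal (core e a)"
      using q by (auto simp: core_def indicator_def abs_le_iff intro!: ennreal_leI powr_mono2')
  qed measurable
  also have "(\<integral>\<^sup>+ s. ennreal (core e s) \<partial>lborel) \<le> ennreal (2 * (e powr (q - 1) / (q - 1)))"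
    using nn_integral_abs_powr_le[of "q - 2" e] q assms(2)
    by (simp add: core_def ennreal_mult' ennreal_indicator)
  also have "ennreal (C / norm x) * ennreal (2 * (e powr (q - 1) / (q - 1)))
      = ennreal (C / norm x * (2 * (e powr (q - 1) / (q - 1))))"
    using C_nonneg q by (intro ennreal_mult[symmetric]) auto
  finally show ?thesis by (simp add: mult_left_mono)
qed

lemma integrable_bounded_borel:
  fixes g :: "'a \<Rightarrow> 'b::{banach, second_countable_topology}"
  assumes "g \<in> borel_measurable borel" and "\<And>y. norm y \<le> 1 \<Longrightarrow> norm (g y) \<le> B"
  shows "integrable M g"
proof (rule integrable_const_bound)
  show "AE y in M. norm (g y) \<le> B"
    using AE_norm_le_1 by eventually_elim (rule assms(2))
  show "g \<in> borel_measurable M"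
    using assms(1) by (simp cong: measurable_cong_sets add: sets_M)
qed

lemma integrable_core:
  assumes "x \<noteq> 0" "e > 0"
  shows "integrable M (\<lambda>y. core e (x \<bullet> y))"
proof (rule integrableI_nonneg)
  show "(\<integral>\<^sup>+ y. ennreal (core e (x \<bullet> y)) \<partial>M) < \<infinity>"
    using nn_integral_core_le[OF assms] by (rule order.strict_trans1) simp
qed (use core_nonneg in \<open>auto\<close>)

lemma integral_core_le:
  assumes "x \<noteq> 0" "e > 0"
  shows "(LINT y|M. core e (x \<bullet> y)) \<le> C / norm x * (2 * (e powr (q - 1) / (q - 1)))"
  using nn_integral_core_le[OF assms] assms C_nonneg q core_nonneg
  by (intro integral_real_bounded) auto

text \<open>\<open>core 1\<close> takes care of \<open>\<bar>t\<bar> \<le> 1\<close>. Beyond that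
  the kernel is at most \<open>R powr (p - 2)\<close> if \<open>p \<ge> 2\<close>, and at most 1
  otherwise.\<close>

lemma weight_le:
  assumes "t \<noteq> 0" "\<bar>t\<bar> \<le> R" "R \<ge> 1"
  shows "\<bar>t\<bar> powr (p - 2) \<le> core 1 t + R powr (p - 2) + 1"
proof (cases "\<bar>t\<bar> \<le> 1")
  case True
  then have "\<bar>t\<bar> powr (p - 2) \<le> \<bar>t\<bar> powr (q - 2)"
    using assms(1) q by (intro powr_mono') auto
  with True show ?thesis using powr_ge_zero[of R "p - 2"] by (simp add: core_def abs_le_iff del: powr_ge_zero)
next
  case False
  have "\<bar>t\<bar> powr (p - 2) \<le> R powr (p - 2) + 1"
  proof (cases "p \<ge> 2")
    case True
    then have "\<bar>t\<bar> powr (p - 2) \<le> R powr (p - 2)"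
      using assms by (intro powr_mono2) auto
    then show ?thesis by simp
  next
    case False
    then have "\<bar>t\<bar> powr (p - 2) \<le> 1 powr (p - 2)"
      using \<open>\<not> \<bar>t\<bar> \<le> 1\<close> by (intro powr_mono2') auto
    then show ?thesis by (simp add: add_increasing)
  qed
  then show ?thesis using core_nonneg[of 1 t] by simp
qed

lemma abs_inner_le_norm:
  fixes x y :: 'a
  assumes "norm y \<le> 1"
  shows "\<bar>x \<bullet> y\<bar> \<le> norm x"
  using Cauchy_Schwarz_ineq2[of x y] mult_left_mono[OF assms, of "norm x"] by simp

lemma integrable_weight:
  assumes "x \<noteq> 0"
  shows "integrable M (\<lambda>y. \<bar>x \<bullet> y\<bar> powr (p - 2))"
proof (rule Bochner_Integration.integrable_bound)
  let ?R = "norm x + 1"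
  show "integrable M (\<lambda>y. core 1 (x \<bullet> y) + ?R powr (p - 2) + 1)"
    using integrable_core[OF assms, of 1] by simp
  show "AE y in M. norm (\<bar>x \<bullet> y\<bar> powr (p - 2)) \<le> norm (core 1 (x \<bullet> y) + ?R powr (p - 2) + 1)"
    using AE_norm_le_1 AE_inner_nonzero[OF assms]
  proof eventually_elim
    fix y assume y: "norm y \<le> 1" "x \<bullet> y \<noteq> 0"
    then have "\<bar>x \<bullet> y\<bar> powr (p - 2) \<le> core 1 (x \<bullet> y) + ?R powr (p - 2) + 1"
      using abs_inner_le_norm[of y x] by (intro weight_le) auto
    then show "norm (\<bar>x \<bullet> y\<bar> powr (p - 2)) \<le> norm (core 1 (x \<bullet> y) + ?R powr (p - 2) + 1)"
      by simp
  qed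
qed measurable

section \<open>The transform, its gradient and its Hessian\<close>

definition F :: "'a \<Rightarrow> real" where
  "F x = (LINT y|M. \<bar>x \<bullet> y\<bar> powr p)"

text \<open>Up to the factor \<open>p\<close>, these are the gradient and the Hessian of \<open>F\<close>.\<close>

definition N :: "'a \<Rightarrow> 'a" where
  "N x = (LINT y|M. signed_powr p (x \<bullet> y) *\<^sub>R y)"

definition A :: "'a \<Rightarrow> 'a \<Rightarrow> 'a" where
  "A x v = (LINT y|M. ((p - 1) * \<bar>x \<bullet> y\<bar> powr (p - 2) * (v \<bullet> y)) *\<^sub>R y)"

lemma integrable_F: "integrable M (\<lambda>y. \<bar>x \<bullet> y\<bar> powr p)"
  by (rule integrable_bounded_borel[where B = "norm x powr p"])
    (use p_gt_1 in \<open>auto intro!: powr_mono2 abs_inner_le_norm\<close>)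

lemma integrable_N: "integrable M (\<lambda>y. signed_powr p (x \<bullet> y) *\<^sub>R y)"
proof (rule integrable_bounded_borel[where B = "norm x powr (p - 1)"])
  fix y :: 'a assume y: "norm y \<le> 1"
  have "norm (signed_powr p (x \<bullet> y) *\<^sub>R y) = \<bar>x \<bullet> y\<bar> powr (p - 1) * norm y"
    by (simp add: abs_signed_powr)
  also have "\<dots> \<le> norm x powr (p - 1) * 1"
    using p_gt_1 y by (intro mult_mono powr_mono2 abs_inner_le_norm) auto
  finally show "norm (signed_powr p (x \<bullet> y) *\<^sub>R y) \<le> norm x powr (p - 1)" by simp
qed measurable

lemma norm_A_integrand_le:
  fixes v y :: 'a
  assumes "norm y \<le> 1"
  shows "norm ((c * (v \<bullet> y)) *\<^sub>R y) \<le> norm v * \<bar>c\<bar>"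
proof -
  have "norm ((c * (v \<bullet> y)) *\<^sub>R y) = (\<bar>c\<bar> * \<bar>v \<bullet> y\<bar>) * norm y"
    by (simp add: abs_mult)
  also have "\<dots> \<le> (\<bar>c\<bar> * norm v) * 1"
    using assms by (intro mult_mono abs_inner_le_norm) auto
  finally show ?thesis by (simp add: mult.commute)
qed

lemma integrable_weighted:
  fixes g :: "'a \<Rightarrow> real"
  assumes "integrable M g"
  shows "integrable M (\<lambda>y. (g y * (v \<bullet> y)) *\<^sub>R y)"
proof (rule Bochner_Integration.integrable_bound)
  show "integrable M (\<lambda>y. norm v * \<bar>g y\<bar>)" using assms by simp
  show "AE y in M. norm ((g y * (v \<bullet> y)) *\<^sub>R y) \<le> norm (norm v * \<bar>g y\<bar>)"
    using AE_norm_le_1 by eventually_elim (simp add: norm_A_integrand_le del: norm_scaleR)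
  show "(\<lambda>y. (g y * (v \<bullet> y)) *\<^sub>R y) \<in> borel_measurable M"
    using borel_measurable_integrable[OF assms] by measurable
qed

lemma integrable_A:
  assumes "x \<noteq> 0"
  shows "integrable M (\<lambda>y. ((p - 1) * \<bar>x \<bullet> y\<bar> powr (p - 2) * (v \<bullet> y)) *\<^sub>R y)"
  using integrable_weighted[OF integrable_mult_right[OF integrable_weight[OF assms], of "p - 1"]]
  by simp

lemma inner_N: "N x \<bullet> v = (LINT y|M. signed_powr p (x \<bullet> y) * (y \<bullet> v))"
  unfolding N_def using integral_inner_left[OF integrable_N[of x], of v] by simp

lemma integrable_inner_N: "integrable M (\<lambda>y. signed_powr p (x \<bullet> y) * (y \<bullet> v))"
  using integrable_inner_left[OF integrable_N[of x], of v] by simp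

lemma inner_A:
  assumes "x \<noteq> 0"
  shows "A x v \<bullet> u = (LINT y|M. (p - 1) * \<bar>x \<bullet> y\<bar> powr (p - 2) * (v \<bullet> y) * (y \<bullet> u))"
  unfolding A_def using integral_inner_left[OF integrable_A[OF assms, of v], of u] by simp

lemma linear_A:
  assumes "x \<noteq> 0"
  shows "linear (A x)"
proof (rule linearI)
  show "A x (u + v) = A x u + A x v" for u v
    unfolding A_def using integrable_A[OF assms]
    by (subst Bochner_Integration.integral_add[symmetric]) (auto simp: algebra_simps)
  show "A x (c *\<^sub>R v) = c *\<^sub>R A x v" for c v
    unfolding A_def by (subst integral_scaleR_right[symmetric]) (simp add: mult_ac)
qed

lemma A_sym:
  assumes "x \<noteq> 0"
  shows "A x u \<bullet> v = u \<bullet> A x v"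
proof -
  have "A x u \<bullet> v = A x v \<bullet> u"
    unfolding inner_A[OF assms] by (intro Bochner_Integration.integral_cong) (auto simp: inner_commute)
  then show ?thesis by (simp add: inner_commute)
qed

text \<open>Euler's relation for \<open>N\<close>, which is homogeneous of degree
  \<open>p - 1\<close>; the next lemma is the one for \<open>F\<close>, of degree
  \<open>p\<close>.\<close>

lemma A_self: "A x x = (p - 1) *\<^sub>R N x"
  unfolding A_def N_def
  by (subst integral_scaleR_right[symmetric]) (simp add: signed_powr_eq mult_ac)

lemma N_inner_self: "N x \<bullet> x = F x"
  unfolding inner_N F_def by (simp add: inner_commute[of _ x] signed_powr_mult_self)

lemma F_scale: "F (c *\<^sub>R x) = \<bar>c\<bar> powr p * F x"
  unfolding F_def by (subst integral_mult_right_zero[symmetric]) (simp add: abs_mult powr_mult)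

text \<open>As \<open>M\<close> has positive mass, a property valid almost everywhere holds
  somewhere. The strict inequalities for \<open>F\<close> and \<open>A\<close> and the injectivity
  of \<open>N\<close> end in this contradiction.\<close>

lemma not_AE_False: "\<not> (AE y in M. False)"
  using emeasure_UNIV_nonzero 
  by (simp add: ae_filter_eq_bot_iff space_M trivial_limit_def[symmetric])

text \<open>Convexity of \<open>F\<close>, obtained by integrating the scalar tangent-line bound
  over \<open>y\<close>.\<close>

lemma F_tangent: "F x + p * (N x \<bullet> (z - x)) \<le> F z"
proof -
  have "F x + p * (N x \<bullet> (z - x)) = (LINT y|M. \<bar>x \<bullet> y\<bar> powr p + p * (signed_powr p (x \<bullet> y) * (y \<bullet> (z - x))))"
    unfolding inner_N F_def using integrable_F[of x] integrable_inner_N[of x "z - x"]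
    by (subst Bochner_Integration.integral_add) auto
  also have "\<dots> \<le> F z"
    unfolding F_def
  proof (rule integral_mono)
    fix y
    show "\<bar>x \<bullet> y\<bar> powr p + p * (signed_powr p (x \<bullet> y) * (y \<bullet> (z - x))) \<le> \<bar>z \<bullet> y\<bar> powr p"
      using powr_tangent_le[OF p_gt_1, of "x \<bullet> y" "z \<bullet> y"]
      by (simp add: inner_diff_right inner_commute)
  qed (use integrable_F integrable_inner_N[of x "z - x"] in auto)
  finally show ?thesis .
qed

lemma F_pos:
  assumes "x \<noteq> 0"
  shows "F x > 0"
proof -
  have "F x \<noteq> 0"
  proof
    assume "F x = 0"
    then have "AE y in M. \<bar>x \<bullet> y\<bar> powr p = 0"
      using integral_nonneg_eq_0_iff_AE[OF integrable_F, of x] by (simp add: F_def)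
    with AE_inner_nonzero[OF assms] have "AE y in M. False"
      by eventually_elim auto
    then show False using not_AE_False by blast
  qed
  moreover have "F x \<ge> 0" unfolding F_def by (rule Bochner_Integration.integral_nonneg) simp
  ultimately show ?thesis by simp
qed

text \<open>The integrand is strictly positive off the hyperplanes orthogonal to \<open>x\<close>
  and to \<open>v\<close>, and both are null sets.\<close>

lemma A_pos:
  assumes "x \<noteq> 0" "v \<noteq> 0"
  shows "A x v \<bullet> v > 0"
proof -
  let ?g = "\<lambda>y. (p - 1) * \<bar>x \<bullet> y\<bar> powr (p - 2) * (v \<bullet> y) * (y \<bullet> v)"
  have int: "integrable M ?g"
    using integrable_inner_left[OF integrable_A[OF assms(1), of v], of v] by simp
  have nonneg: "0 \<le> ?g y" for y
    using p_gt_1 by (simp add: inner_commute[of y v] mult.assoc)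
  have "A x v \<bullet> v \<noteq> 0"
  proof
    assume "A x v \<bullet> v = 0"
    then have "AE y in M. ?g y = 0"
      using integral_nonneg_eq_0_iff_AE[OF int] nonneg by (simp add: inner_A[OF assms(1)])
    with AE_inner_nonzero[OF assms(1)] AE_inner_nonzero[OF assms(2)] have "AE y in M. False"
      by eventually_elim (use p_gt_1 in \<open>auto simp: inner_commute\<close>)
    then show False using not_AE_False by blast
  qed
  moreover have "A x v \<bullet> v \<ge> 0"
    unfolding inner_A[OF assms(1)] using nonneg by (intro Bochner_Integration.integral_nonneg) auto
  ultimately show ?thesis by simp
qed

text \<open>Strict monotonicity: \<open>(N a - N b) \<bullet> (a - b)\<close> is the integral of a
  function that is positive off a null hyperplane, since \<open>signed_powr p\<close> is strictly
  increasing.\<close>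

lemma N_inj:
  assumes "N a = N b"
  shows "a = b"
proof (rule ccontr)
  assume "a \<noteq> b"
  let ?g = "\<lambda>y. (signed_powr p (a \<bullet> y) - signed_powr p (b \<bullet> y)) * (y \<bullet> (a - b))"
  have int: "integrable M ?g"
    using integrable_inner_N[of a "a - b"] integrable_inner_N[of b "a - b"]
    by (simp add: left_diff_distrib)
  have pos: "0 < ?g y" if "(a - b) \<bullet> y \<noteq> 0" for y
    using that signed_powr_strict_mono[OF p_gt_1, of "a \<bullet> y" "b \<bullet> y"]
      signed_powr_strict_mono[OF p_gt_1, of "b \<bullet> y" "a \<bullet> y"]
    by (cases "a \<bullet> y" "b \<bullet> y" rule: linorder_cases)
      (auto simp: inner_diff_left inner_diff_right inner_commute[of y] intro: mult_neg_neg)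
  have nonneg: "0 \<le> ?g y" for y
    using pos[of y] by (cases "(a - b) \<bullet> y = 0") (auto simp: inner_commute)
  have "(LINT y|M. ?g y) = (N a - N b) \<bullet> (a - b)"
    unfolding inner_diff_left[of "N a"] inner_N
    using integrable_inner_N[of a "a - b"] integrable_inner_N[of b "a - b"]
    by (subst Bochner_Integration.integral_diff[symmetric]) (auto simp: left_diff_distrib)
  then have "AE y in M. ?g y = 0"
    using integral_nonneg_eq_0_iff_AE[OF int] nonneg assms by simp
  moreover have "AE y in M. (a - b) \<bullet> y \<noteq> 0"
    using \<open>a \<noteq> b\<close> by (intro AE_inner_nonzero) simp
  ultimately have "AE y in M. False"
    by eventually_elim (use pos in force)
  then show False using not_AE_False by blast
qed


section \<open>Differentiation under the integral sign\<close>

text \<open>Dominated convergence for the remainder quotients along sequences tending to 0. The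
  integrand is differentiable at \<open>x\<close> for all \<open>y\<close> off the null hyperplane
  \<open>x \<bullet> y = 0\<close>.\<close>

lemma N_has_derivative:
  assumes x: "x \<noteq> 0"
  shows "(N has_derivative A x) (at x)"
  unfolding has_derivative_at
proof
  show "bounded_linear (A x)"
    using linear_A[OF x] by (simp add: linear_conv_bounded_linear)
  define r where "r h y = signed_powr p ((x + h) \<bullet> y) - signed_powr p (x \<bullet> y)
    - (p - 1) * \<bar>x \<bullet> y\<bar> powr (p - 2) * (h \<bullet> y)" for h y
  have [measurable]: "r h \<in> borel_measurable borel" for h
    unfolding r_def by measurable
  \<comment> \<open>\<open>R\<close> bounds both inner products as long as
    \<open>norm h \<le> 1\<close>. In \<open>B\<close> the first summand comes from
    \<open>signed_powr_diff_le\<close> with \<open>M = R\<close>, the second from the linear term of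
    the remainder.\<close>
  define R where "R = norm x + 1"
  define B where "B y = 3 * (\<bar>x \<bullet> y\<bar> powr (p - 2) + p * R powr (p - 2))
    + (p - 1) * \<bar>x \<bullet> y\<bar> powr (p - 2)" for y
  have B: "integrable M B"
    unfolding B_def using integrable_weight[OF x] by simp
  have r_le: "\<bar>r h y\<bar> \<le> norm h * B y" if y: "norm y \<le> 1" "x \<bullet> y \<noteq> 0" and h: "norm h \<le> 1" for h y
  proof -
    have "\<bar>(x + h) \<bullet> y\<bar> \<le> R" "\<bar>x \<bullet> y\<bar> \<le> R"
      using abs_inner_le_norm[OF y(1), of "x + h"] abs_inner_le_norm[OF y(1), of x]
        norm_triangle_ineq[of x h] h unfolding R_def by auto
    then have "\<bar>signed_powr p ((x + h) \<bullet> y) - signed_powr p (x \<bullet> y)\<bar>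
        \<le> \<bar>(x + h) \<bullet> y - x \<bullet> y\<bar> * (3 * (\<bar>x \<bullet> y\<bar> powr (p - 2) + p * R powr (p - 2)))"
      using y by (intro signed_powr_diff_le p_gt_1) auto
    also have "\<dots> \<le> norm h * (3 * (\<bar>x \<bullet> y\<bar> powr (p - 2) + p * R powr (p - 2)))"
      using abs_inner_le_norm[OF y(1), of h] p_gt_1 by (intro mult_right_mono) (auto simp: inner_add_left)
    finally have 1: "\<bar>signed_powr p ((x + h) \<bullet> y) - signed_powr p (x \<bullet> y)\<bar> \<le> \<dots>" .
    have "\<bar>(p - 1) * \<bar>x \<bullet> y\<bar> powr (p - 2) * (h \<bullet> y)\<bar> = \<bar>h \<bullet> y\<bar> * ((p - 1) * \<bar>x \<bullet> y\<bar> powr (p - 2))"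
      using p_gt_1 by (simp add: abs_mult)
    also have "\<dots> \<le> norm h * ((p - 1) * \<bar>x \<bullet> y\<bar> powr (p - 2))"
      using abs_inner_le_norm[OF y(1), of h] p_gt_1 by (intro mult_right_mono) auto
    finally show ?thesis using 1 unfolding r_def B_def distrib_left by linarith
  qed
  have r_lim: "((\<lambda>h. \<bar>r h y\<bar> / norm h) \<longlongrightarrow> 0) (at 0)" if y: "x \<bullet> y \<noteq> 0" for y
  proof -
    have "(signed_powr p has_derivative (\<lambda>t. (p - 1) * \<bar>x \<bullet> y\<bar> powr (p - 2) * t)) (at (x \<bullet> y))"
      using has_real_derivative_signed_powr[OF y] by (simp add: has_field_derivative_def)
    moreover have "((\<lambda>z. z \<bullet> y) has_derivative (\<lambda>h. h \<bullet> y)) (at x)"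
      by (auto intro!: derivative_eq_intros)
    ultimately have "((\<lambda>z. signed_powr p (z \<bullet> y)) has_derivative
        (\<lambda>h. (p - 1) * \<bar>x \<bullet> y\<bar> powr (p - 2) * (h \<bullet> y))) (at x)"
      using has_derivative_compose[of "\<lambda>z. z \<bullet> y" "\<lambda>h. h \<bullet> y" x UNIV "signed_powr p"] by simp
    then show ?thesis unfolding has_derivative_at r_def by simp
  qed
  have eq: "N (x + h) - N x - A x h = (LINT y|M. r h y *\<^sub>R y)" for h
    unfolding N_def A_def r_def using integrable_N integrable_A[OF x]
    by (simp add: scaleR_diff_left)
  show "(\<lambda>h. norm (N (x + h) - N x - A x h) / norm h) \<midarrow>0\<rightarrow> 0"
    unfolding tendsto_at_iff_sequentially o_def
  proof (intro allI impI)
    fix X :: "nat \<Rightarrow> 'a" assume X0: "\<forall>i. X i \<in> UNIV - {0}" and X: "X \<longlonglongrightarrow> 0"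
    obtain n0 where n0: "\<And>n. n \<ge> n0 \<Longrightarrow> norm (X n) \<le> 1"
      using LIMSEQ_D[OF X, of 1] by (auto intro: less_imp_le)
    let ?Y = "\<lambda>n. X (n + n0)"
    have Y: "norm (?Y n) \<le> 1" "?Y n \<noteq> 0" for n using n0 X0 by auto
    have Ylim: "filterlim ?Y (at 0) sequentially"
      unfolding filterlim_at using LIMSEQ_ignore_initial_segment[OF X] Y by auto
    have "(\<lambda>n. LINT y|M. (r (?Y n) y / norm (?Y n)) *\<^sub>R y) \<longlonglongrightarrow> (LINT y|M. 0)"
    proof (rule integral_dominated_convergence[where w = B])
      show "AE y in M. (\<lambda>n. (r (?Y n) y / norm (?Y n)) *\<^sub>R y) \<longlonglongrightarrow> 0"
        using AE_inner_nonzero[OF x]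
      proof eventually_elim
        fix y assume "x \<bullet> y \<noteq> 0"
        from filterlim_compose[OF r_lim[OF this] Ylim]
        have "(\<lambda>n. \<bar>r (?Y n) y / norm (?Y n)\<bar>) \<longlonglongrightarrow> 0" by simp
        then have "(\<lambda>n. r (?Y n) y / norm (?Y n)) \<longlonglongrightarrow> 0" by (rule tendsto_rabs_zero_cancel)
        from tendsto_scaleR[OF this tendsto_const[of y]]
        show "(\<lambda>n. (r (?Y n) y / norm (?Y n)) *\<^sub>R y) \<longlonglongrightarrow> 0" by simp
      qed
      show "AE y in M. norm ((r (?Y n) y / norm (?Y n)) *\<^sub>R y) \<le> B y" for n
        using AE_inner_nonzero[OF x] AE_norm_le_1
      proof eventually_elim
        fix y assume y: "x \<bullet> y \<noteq> 0" "norm y \<le> 1"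
        have r: "\<bar>r (?Y n) y\<bar> / norm (?Y n) \<le> B y"
          using r_le[OF y(2,1) Y(1)[of n]] Y(2)[of n] by (simp add: divide_le_eq mult.commute)
        have "norm ((r (?Y n) y / norm (?Y n)) *\<^sub>R y) = \<bar>r (?Y n) y\<bar> / norm (?Y n) * norm y" by simp
        also have "\<dots> \<le> B y * 1"
          using r y by (intro mult_mono) (auto intro: order_trans[OF _ r])
        finally show "norm ((r (?Y n) y / norm (?Y n)) *\<^sub>R y) \<le> B y" by simp
      qed
    qed (use B in measurable)
    then have "(\<lambda>n. norm (LINT y|M. (r (?Y n) y / norm (?Y n)) *\<^sub>R y)) \<longlonglongrightarrow> 0"
      using tendsto_norm_zero by simp
    moreover have "norm (LINT y|M. (r (?Y n) y / norm (?Y n)) *\<^sub>R y)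
        = norm (N (x + ?Y n) - N x - A x (?Y n)) / norm (?Y n)" for n
    proof -
      have "(LINT y|M. (r (?Y n) y / norm (?Y n)) *\<^sub>R y)
          = (LINT y|M. (1 / norm (?Y n)) *\<^sub>R (r (?Y n) y *\<^sub>R y))"
        by (intro Bochner_Integration.integral_cong) (auto simp: divide_inverse)
      also have "\<dots> = (1 / norm (?Y n)) *\<^sub>R (N (x + ?Y n) - N x - A x (?Y n))"
        unfolding eq by (rule integral_scaleR_right)
      finally show ?thesis by simp
    qed
    ultimately have "(\<lambda>n. norm (N (x + ?Y n) - N x - A x (?Y n)) / norm (?Y n)) \<longlonglongrightarrow> 0"
      by simp
    then show "(\<lambda>n. norm (N (x + X n) - N x - A x (X n)) / norm (X n)) \<longlonglongrightarrow> 0"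
      by (rule LIMSEQ_offset)
  qed
qed

section \<open>Truncated kernels and continuity of the Hessian\<close>

definition e :: "nat \<Rightarrow> real" where "e k = 1 / real (Suc k)"

lemma e: "0 < e k" "e k \<le> 1"
  by (auto simp: e_def)

lemma e_LIMSEQ: "e \<longlonglongrightarrow> 0"
  unfolding e_def[abs_def] using LIMSEQ_inverse_real_of_nat by (simp add: inverse_eq_divide)

text \<open>The Hessian kernel made constant for \<open>\<bar>t\<bar> \<le> e k\<close>, which
  removes its singularity; it is continuous and bounded on bounded sets.\<close>

definition W :: "nat \<Rightarrow> real \<Rightarrow> real" where
  "W k t = max \<bar>t\<bar> (e k) powr (p - 2)"

lemma borel_measurable_W [measurable]: "W k \<in> borel_measurable borel"
  unfolding W_def by measurable

text \<open>For \<open>\<bar>t\<bar> \<le> e k \<le> 1\<close> both values lie between 0 and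
  \<open>\<bar>t\<bar> powr (q - 2)\<close>, because \<open>q \<le> p\<close> and
  \<open>q \<le> 2\<close>; otherwise they coincide.\<close>

lemma W_diff_le:
  assumes "t \<noteq> 0"
  shows "\<bar>W k t - \<bar>t\<bar> powr (p - 2)\<bar> \<le> core (e k) t"
proof (cases "\<bar>t\<bar> \<le> e k")
  case True
  have "\<bar>t\<bar> powr (p - 2) \<le> \<bar>t\<bar> powr (q - 2)"
    using assms True e[of k] q by (intro powr_mono') auto
  moreover have "e k powr (p - 2) \<le> \<bar>t\<bar> powr (q - 2)"
  proof -
    have "e k powr (p - 2) \<le> e k powr (q - 2)"
      using e[of k] q by (intro powr_mono') auto
    also have "\<dots> \<le> \<bar>t\<bar> powr (q - 2)"
      using True assms q by (intro powr_mono2') auto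
    finally show ?thesis .
  qed
  moreover have "0 \<le> \<bar>t\<bar> powr (p - 2)" "0 \<le> e k powr (p - 2)" by simp_all
  ultimately have "\<bar>e k powr (p - 2) - \<bar>t\<bar> powr (p - 2)\<bar> \<le> \<bar>t\<bar> powr (q - 2)"
    by linarith
  then show ?thesis
    using True by (simp add: W_def core_def abs_le_iff)
next
  case False
  then show ?thesis using core_nonneg by (simp add: W_def)
qed

lemma W_le:
  assumes "\<bar>t\<bar> \<le> R" "R \<ge> 1"
  shows "\<bar>W k t\<bar> \<le> e k powr (p - 2) + R powr (p - 2)"
proof -
  let ?m = "max \<bar>t\<bar> (e k)"
  have m: "e k \<le> ?m" "?m \<le> R" "0 < ?m" using assms e[of k] by auto
  show ?thesis
  proof (cases "p \<ge> 2")
    case True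
    then have "?m powr (p - 2) \<le> R powr (p - 2)" using m by (intro powr_mono2) auto
    then show ?thesis by (simp add: W_def add_increasing)
  next
    case False
    then have "?m powr (p - 2) \<le> e k powr (p - 2)" using m e[of k] by (intro powr_mono2') auto
    then show ?thesis by (simp add: W_def add_increasing2)
  qed
qed

lemma W_continuous: "continuous_on UNIV (W k)"
  unfolding W_def
proof (rule continuous_on_powr)
  show "\<forall>t\<in>UNIV. max \<bar>t\<bar> (e k) \<noteq> 0"
    using e(1)[of k] by (auto simp: max_def)
qed (intro continuous_intros)+

definition A_trunc :: "nat \<Rightarrow> 'a \<Rightarrow> 'a \<Rightarrow> 'a" where
  "A_trunc k x v = (LINT y|M. ((p - 1) * W k (x \<bullet> y) * (v \<bullet> y)) *\<^sub>R y)"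

lemma integrable_W: "integrable M (\<lambda>y. W k (x \<bullet> y))"
proof (rule integrable_bounded_borel)
  fix y :: 'a assume "norm y \<le> 1"
  then have "\<bar>x \<bullet> y\<bar> \<le> norm x + 1" using abs_inner_le_norm[of y x] by simp
  then show "norm (W k (x \<bullet> y)) \<le> e k powr (p - 2) + (norm x + 1) powr (p - 2)"
    unfolding real_norm_def by (rule W_le) simp
qed measurable

lemma A_trunc_continuous: "continuous_on UNIV (\<lambda>x. A_trunc k x v)"
  unfolding continuous_on_sequentially o_def
proof (intro ballI allI impI)
  fix X :: "nat \<Rightarrow> 'a" and a assume "(\<forall>n. X n \<in> UNIV) \<and> X \<longlonglongrightarrow> a"
  then have X: "X \<longlonglongrightarrow> a" by simp
  then obtain R0 where R0: "\<And>n. norm (X n) \<le> R0"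
    using convergent_imp_Bseq[of X] by (auto simp: convergent_def Bseq_def)
  define R where "R = max 1 R0"
  let ?B = "norm v * ((p - 1) * (e k powr (p - 2) + R powr (p - 2)))"
  show "(\<lambda>n. A_trunc k (X n) v) \<longlonglongrightarrow> A_trunc k a v"
    unfolding A_trunc_def
  proof (rule integral_dominated_convergence[where w = "\<lambda>_. ?B"])
    show "AE y in M. (\<lambda>n. ((p - 1) * W k (X n \<bullet> y) * (v \<bullet> y)) *\<^sub>R y)
        \<longlonglongrightarrow> ((p - 1) * W k (a \<bullet> y) * (v \<bullet> y)) *\<^sub>R y"
    proof (rule AE_I2)
      fix y
      have "(\<lambda>n. W k (X n \<bullet> y)) \<longlonglongrightarrow> W k (a \<bullet> y)"
        using W_continuous[of k] X
        by (intro continuous_on_tendsto_compose[OF W_continuous[of k]] tendsto_intros) auto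
      then show "(\<lambda>n. ((p - 1) * W k (X n \<bullet> y) * (v \<bullet> y)) *\<^sub>R y)
          \<longlonglongrightarrow> ((p - 1) * W k (a \<bullet> y) * (v \<bullet> y)) *\<^sub>R y"
        by (intro tendsto_intros)
    qed
    show "AE y in M. norm (((p - 1) * W k (X n \<bullet> y) * (v \<bullet> y)) *\<^sub>R y) \<le> ?B" for n
      using AE_norm_le_1
    proof eventually_elim
      fix y :: 'a assume y: "norm y \<le> 1"
      have "\<bar>W k (X n \<bullet> y)\<bar> \<le> e k powr (p - 2) + R powr (p - 2)"
        using abs_inner_le_norm[OF y, of "X n"] R0[of n] by (intro W_le) (auto simp: R_def)
      then have "\<bar>(p - 1) * W k (X n \<bullet> y)\<bar> \<le> (p - 1) * (e k powr (p - 2) + R powr (p - 2))"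
        using p_gt_1 by (simp add: abs_mult)
      then show "norm (((p - 1) * W k (X n \<bullet> y) * (v \<bullet> y)) *\<^sub>R y) \<le> ?B"
        by (intro order.trans[OF norm_A_integrand_le[OF y]] mult_left_mono) auto
    qed
  qed measurable
qed

text \<open>The two kernels differ only on a thin slab, where \<open>core (e k)\<close> bounds the
  error. The estimate depends on \<open>x\<close> through \<open>norm x\<close> alone, hence is
  uniform away from 0.\<close>

lemma A_trunc_diff_le:
  assumes x: "x \<noteq> 0"
  shows "norm (A_trunc k x v - A x v)
    \<le> norm v * ((p - 1) * (C / norm x * (2 * (e k powr (q - 1) / (q - 1)))))"
proof -
  let ?d = "\<lambda>y. (p - 1) * (W k (x \<bullet> y) - \<bar>x \<bullet> y\<bar> powr (p - 2))"
  have int: "integrable M ?d"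
    using integrable_W integrable_weight[OF x] by simp
  have "A_trunc k x v - A x v = (LINT y|M. (?d y * (v \<bullet> y)) *\<^sub>R y)"
    unfolding A_trunc_def A_def
    using integrable_A[OF x, of v]
      integrable_weighted[OF integrable_mult_right[OF integrable_W[of k x], of "p - 1"], of v]
    by (subst Bochner_Integration.integral_diff[symmetric])
      (auto simp: algebra_simps)
  also have "norm \<dots> \<le> (LINT y|M. norm ((?d y * (v \<bullet> y)) *\<^sub>R y))"
    by (rule integral_norm_bound)
  also have "\<dots> \<le> (LINT y|M. norm v * ((p - 1) * core (e k) (x \<bullet> y)))"
  proof (rule integral_mono_AE)
    show "integrable M (\<lambda>y. norm ((?d y * (v \<bullet> y)) *\<^sub>R y))"
      using integrable_weighted[OF int, of v] by (rule integrable_norm)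
    show "integrable M (\<lambda>y. norm v * ((p - 1) * core (e k) (x \<bullet> y)))"
      using integrable_core[OF x e(1)] by simp
    show "AE y in M. norm ((?d y * (v \<bullet> y)) *\<^sub>R y) \<le> norm v * ((p - 1) * core (e k) (x \<bullet> y))"
      using AE_norm_le_1 AE_inner_nonzero[OF x]
    proof eventually_elim
      fix y assume y: "norm y \<le> 1" "x \<bullet> y \<noteq> 0"
      have "\<bar>?d y\<bar> \<le> (p - 1) * core (e k) (x \<bullet> y)"
        using p_gt_1 W_diff_le[OF y(2), of k] by (simp add: abs_mult)
      then show "norm ((?d y * (v \<bullet> y)) *\<^sub>R y) \<le> norm v * ((p - 1) * core (e k) (x \<bullet> y))"
        by (intro order.trans[OF norm_A_integrand_le[OF y(1)]] mult_left_mono) auto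
    qed
  qed
  also have "\<dots> = norm v * ((p - 1) * (LINT y|M. core (e k) (x \<bullet> y)))"
    by simp
  also have "\<dots> \<le> norm v * ((p - 1) * (C / norm x * (2 * (e k powr (q - 1) / (q - 1)))))"
    using p_gt_1 by (intro mult_left_mono integral_core_le x e) auto
  finally show ?thesis .
qed

text \<open>On each set \<open>norm x > d\<close> the map is a uniform limit of the continuous
  truncations, and these open sets exhaust the complement of 0.\<close>

lemma A_continuous: "continuous_on (- {0}) (\<lambda>x. A x v)"
proof -
  have cont: "continuous_on {x::'a. norm x > d} (\<lambda>x. A x v)" if d: "d > 0" for d
  proof (rule uniform_limit_theorem)
    show "\<forall>\<^sub>F k in sequentially. continuous_on {x::'a. norm x > d} (\<lambda>x. A_trunc k x v)"
      by (intro always_eventually allI continuous_on_subset[OF A_trunc_continuous]) auto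
    let ?b = "\<lambda>k. norm v * ((p - 1) * (C / d * (2 * (e k powr (q - 1) / (q - 1)))))"
    \<comment> \<open>The base tends to 0, so convergence of the power relies on
      \<open>q - 1 > 0\<close>; the limit is 0 since \<open>0 powr (q - 1) = 0\<close>.\<close>
    have b: "?b \<longlonglongrightarrow> norm v * ((p - 1) * (C / d * (2 * (0 powr (q - 1) / (q - 1)))))"
      using q e by (intro tendsto_intros tendsto_powr' e_LIMSEQ) (auto intro!: always_eventually less_imp_le)
    show "uniform_limit {x::'a. norm x > d} (\<lambda>k x. A_trunc k x v) (\<lambda>x. A x v) sequentially"
    proof (rule uniform_limitI)
      fix \<epsilon> :: real assume "\<epsilon> > 0"
      with b have "\<forall>\<^sub>F k in sequentially. ?b k < \<epsilon>"
        by (intro order_tendstoD(2)[OF b]) (use q in simp)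
      then show "\<forall>\<^sub>F k in sequentially. \<forall>x\<in>{x::'a. norm x > d}. dist (A_trunc k x v) (A x v) < \<epsilon>"
      proof eventually_elim
        fix k assume k: "?b k < \<epsilon>"
        show "\<forall>x\<in>{x::'a. norm x > d}. dist (A_trunc k x v) (A x v) < \<epsilon>"
        proof
          fix x assume "x \<in> {x::'a. norm x > d}"
          then have x: "d < norm x" "x \<noteq> 0" using d by auto
          have "dist (A_trunc k x v) (A x v)
              \<le> norm v * ((p - 1) * (C / norm x * (2 * (e k powr (q - 1) / (q - 1)))))"
            unfolding dist_norm by (rule A_trunc_diff_le[OF x(2)])
          also have "\<dots> \<le> ?b k"
            using p_gt_1 q d x C_nonneg
            by (intro mult_left_mono mult_right_mono divide_left_mono) auto
          finally show "dist (A_trunc k x v) (A x v) < \<epsilon>" using k by simp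
        qed
      qed
    qed
  qed simp
  have "continuous (at x) (\<lambda>x. A x v)" if "x \<noteq> 0" for x
  proof -
    have "open {z::'a. norm x / 2 < norm z}" by (intro open_Collect_less continuous_intros)
    with cont[of "norm x / 2"] that show ?thesis
      by (auto simp: continuous_on_eq_continuous_at)
  qed
  then show ?thesis by (simp add: continuous_on_eq_continuous_at open_Compl)
qed

section \<open>First derivative of the transform\<close>

lemma N_continuous: "continuous_on (- {0}) N"
proof (rule continuous_at_imp_continuous_on, rule ballI)
  fix x :: 'a assume "x \<in> - {0}"
  then show "continuous (at x) N"
    using has_derivative_continuous[OF N_has_derivative[of x]] by simp
qed

text \<open>The tangent-line bounds at \<open>x\<close> and at \<open>x + h\<close> trap the
  remainder between 0 and \<open>p * ((N (x + h) - N x) \<bullet> h)\<close>, which is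
  \<open>o(norm h)\<close> by continuity of \<open>N\<close>.\<close>

lemma F_has_derivative:
  assumes x: "x \<noteq> 0"
  shows "(F has_derivative (\<lambda>h. p * (N x \<bullet> h))) (at x)"
  unfolding has_derivative_at
proof
  show "bounded_linear (\<lambda>h. p * (N x \<bullet> h))"
    by (intro bounded_linear_const_mult bounded_linear_inner_right)
  have "(\<lambda>h. p * norm (N (x + h) - N x)) \<midarrow>0\<rightarrow> p * norm (N x - N x)"
    using has_derivative_continuous[OF N_has_derivative[OF x]]
    by (intro tendsto_intros) (simp add: isCont_iff)
  then have lim: "(\<lambda>h. p * norm (N (x + h) - N x)) \<midarrow>0\<rightarrow> 0" by simp
  show "(\<lambda>h. norm (F (x + h) - F x - p * (N x \<bullet> h)) / norm h) \<midarrow>0\<rightarrow> 0"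
  proof (rule Lim_null_comparison[OF _ lim], rule always_eventually, rule allI)
    fix h
    have "F x + p * (N x \<bullet> h) \<le> F (x + h)"
      using F_tangent[of x "x + h"] by simp
    moreover have "F (x + h) - p * (N (x + h) \<bullet> h) \<le> F x"
      using F_tangent[of "x + h" x] by (simp add: inner_diff_right)
    ultimately have "norm (F (x + h) - F x - p * (N x \<bullet> h)) \<le> p * ((N (x + h) - N x) \<bullet> h)"
      by (simp add: inner_diff_left right_diff_distrib)
    also have "\<dots> \<le> p * (norm (N (x + h) - N x) * norm h)"
      using p_gt_1 norm_cauchy_schwarz by (intro mult_left_mono) auto
    finally show "norm (norm (F (x + h) - F x - p * (N x \<bullet> h)) / norm h) \<le> p * norm (N (x + h) - N x)"
      using p_gt_1 by (cases "h = 0") (auto simp: divide_le_eq mult.assoc)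
  qed
qed
end

text \<open>Rests on the identity \<open>B x - B0 = B x o\<^sub>L (A0 - A x) o\<^sub>L B0\<close>.
  Once the last two factors have norm product below \<open>1 / 2\<close>, absorbing a term gives
  \<open>norm (B x) \<le> 2 * norm B0\<close>, and the identity then bounds the difference.\<close>

lemma blinfun_inverse_tendsto:
  fixes A B :: "'b \<Rightarrow> 'a::euclidean_space \<Rightarrow>\<^sub>L 'a"
  assumes lim: "(A \<longlongrightarrow> A0) G"
    and inv0: "A0 o\<^sub>L B0 = id_blinfun"
    and inv: "\<forall>\<^sub>F x in G. B x o\<^sub>L A x = id_blinfun"
  shows "(B \<longlongrightarrow> B0) G"
proof (rule Lim_null[THEN iffD2], rule Lim_null_comparison)
  have lim0: "((\<lambda>x. norm (A0 - A x)) \<longlongrightarrow> 0) G"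
    using tendsto_norm[OF tendsto_diff[OF tendsto_const[of A0] lim]] by simp
  then have lim1: "((\<lambda>x. norm (A0 - A x) * norm B0) \<longlongrightarrow> 0 * norm B0) G"
    by (intro tendsto_intros)
  then have ev: "\<forall>\<^sub>F x in G. norm (A0 - A x) * norm B0 < 1 / 2"
    by (intro order_tendstoD) auto
  show "((\<lambda>x. 2 * norm B0 * (norm (A0 - A x) * norm B0)) \<longlongrightarrow> 0) G"
    using tendsto_mult_left[OF lim1, of "2 * norm B0"] by simp
  show "\<forall>\<^sub>F x in G. norm (B x - B0) \<le> 2 * norm B0 * (norm (A0 - A x) * norm B0)"
    using ev inv
  proof eventually_elim
    fix x assume small: "norm (A0 - A x) * norm B0 < 1 / 2" and inv: "B x o\<^sub>L A x = id_blinfun"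
    let ?\<delta> = "norm (A0 - A x) * norm B0"
    have "B x o\<^sub>L (A0 - A x) o\<^sub>L B0 = (B x o\<^sub>L (A0 o\<^sub>L B0)) - ((B x o\<^sub>L A x) o\<^sub>L B0)"
      by (rule blinfun_eqI) (simp add: blinfun.diff_left blinfun.diff_right)
    also have "\<dots> = B x - B0"
      unfolding inv inv0 by (rule blinfun_eqI) (simp add: blinfun.diff_left)
    finally have "norm (B x - B0) = norm (B x o\<^sub>L (A0 - A x) o\<^sub>L B0)" by simp
    also have "\<dots> \<le> norm (B x) * norm (A0 - A x) * norm B0"
      by (intro order.trans[OF norm_blinfun_compose] mult_right_mono norm_blinfun_compose) auto
    finally have 1: "norm (B x - B0) \<le> norm (B x) * ?\<delta>" by (simp add: mult.assoc)
    have "norm (B x) \<le> norm (B x - B0) + norm B0"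
      using norm_triangle_sub[of "B x" B0] by simp
    also have "norm (B x - B0) \<le> norm (B x) * (1 / 2)"
      using small by (intro order.trans[OF 1] mult_left_mono) auto
    finally have "norm (B x) \<le> 2 * norm B0" by simp
    then have "norm (B x) * ?\<delta> \<le> 2 * norm B0 * ?\<delta>"
      by (intro mult_right_mono) auto
    with 1 show "norm (B x - B0) \<le> 2 * norm B0 * ?\<delta>" by linarith
  qed
qed

text \<open>The derivative is the orthogonal projection of \<open>h\<close> onto the complement of
  \<open>x\<close>, divided by \<open>norm x\<close>.\<close>

lemma has_derivative_sgn:
  fixes x :: "'a::real_inner"
  assumes "x \<noteq> 0"
  shows "(sgn has_derivative (\<lambda>h. h /\<^sub>R norm x - ((h \<bullet> sgn x) / (norm x)\<^sup>2) *\<^sub>R x)) (at x)"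
proof -
  have "((\<lambda>z. inverse (norm z) *\<^sub>R z) has_derivative
      (\<lambda>h. h /\<^sub>R norm x - ((h \<bullet> sgn x) / (norm x)\<^sup>2) *\<^sub>R x)) (at x)"
    using assms
    by (auto intro!: derivative_eq_intros has_derivative_norm
        simp: fun_eq_iff power2_eq_square divide_inverse)
  then show ?thesis by (simp add: sgn_div_norm[abs_def])
qed

context powr_transform begin

section \<open>The convex body\<close>

definition H :: "'a \<Rightarrow> real" where
  "H x = F x powr (1 / p)"

text \<open>The Wulff shape of \<open>H\<close>; that no half-space is slack is part of
  \<open>support_function_K\<close>.\<close>

definition K :: "'a set" where
  "K = {y. \<forall>x. x \<bullet> y \<le> H x}"

lemma F_0 [simp]: "F 0 = 0"
  by (simp add: F_def)

lemma H_0 [simp]: "H 0 = 0"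
  by (simp add: H_def)

lemma F_nonneg: "0 \<le> F x"
  using F_pos[of x] by (cases "x = 0") auto

lemma H_nonneg: "0 \<le> H x"
  by (simp add: H_def)

lemma H_pos: "x \<noteq> 0 \<Longrightarrow> 0 < H x"
  using F_pos[of x] by (simp add: H_def)

lemma H_powr: "H x powr p = F x"
  using p_gt_1 F_nonneg by (simp add: H_def powr_powr)

lemma H_eq_1_iff: "H x = 1 \<longleftrightarrow> F x = 1"
  using H_powr[of x] F_nonneg[of x] by (auto simp: H_def)

lemma H_scale: "H (c *\<^sub>R x) = \<bar>c\<bar> * H x"
  using p_gt_1 F_nonneg by (simp add: H_def F_scale powr_mult powr_powr)

lemma H_normalize: "x \<noteq> 0 \<Longrightarrow> H ((1 / H x) *\<^sub>R x) = 1"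
  using H_pos[of x] by (simp add: H_scale)

lemma nonzero_if_H_eq_1: "H x = 1 \<Longrightarrow> x \<noteq> 0"
  by auto

text \<open>By Euler's relation \<open>N x \<bullet> x = 1\<close>, so for \<open>H z = 1\<close>
  the tangent-line bound of \<open>F\<close> reduces to \<open>N x \<bullet> z \<le> 1\<close>.
  Homogeneity of \<open>H\<close> extends this to all \<open>z\<close>.\<close>

lemma inner_N_le_H:
  assumes "H x = 1"
  shows "N x \<bullet> z \<le> H z"
proof -
  have *: "N x \<bullet> z \<le> 1" if "H z = 1" for z
  proof -
    have "1 + p * (N x \<bullet> z - 1) \<le> 1"
      using F_tangent[of x z] assms that by (simp add: H_eq_1_iff inner_diff_right N_inner_self)
    then show ?thesis using p_gt_1 by (simp add: mult_le_0_iff)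
  qed
  show ?thesis
  proof (cases "z = 0")
    case False
    have "N x \<bullet> ((1 / H z) *\<^sub>R z) \<le> 1"
      by (rule *[OF H_normalize[OF False]])
    then show ?thesis using H_pos[OF False] by (simp add: divide_le_eq)
  qed simp
qed

lemma N_in_K: "H x = 1 \<Longrightarrow> N x \<in> K"
  using inner_N_le_H[of x] by (simp add: K_def inner_commute)

lemma inner_N_self_eq_1: "H x = 1 \<Longrightarrow> x \<bullet> N x = 1"
  by (simp add: H_eq_1_iff inner_commute[of x] N_inner_self)

text \<open>The point \<open>x\<close> minimises \<open>F z - p * (z \<bullet> y)\<close>, so the gradient vanishes there.\<close>

lemma eq_N_if_inner_eq_1:
  assumes x: "H x = 1" and y: "y \<in> K" "x \<bullet> y = 1"
  shows "y = N x"
proof -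
  have x0: "x \<noteq> 0" using nonzero_if_H_eq_1[OF x] .
  have min: "F x - p * (x \<bullet> y) \<le> F z - p * (z \<bullet> y)" for z
  proof -
    \<comment> \<open>The tangent to \<open>t powr p\<close> at 1, evaluated at \<open>H z\<close>;
      it meets \<open>z \<bullet> y \<le> H z\<close> with equality at \<open>z = x\<close>.\<close>
    have "1 + p * (H z - 1) \<le> F z"
      using powr_tangent_le[OF p_gt_1, of 1 "H z"] H_nonneg[of z] by (simp add: H_powr signed_powr_def)
    moreover have "p * (z \<bullet> y) \<le> p * H z"
      using y p_gt_1 by (intro mult_left_mono) (auto simp: K_def)
    ultimately show ?thesis using x y by (simp add: H_eq_1_iff algebra_simps)
  qed
  have "((\<lambda>z. F z - p * (z \<bullet> y)) has_derivative (\<lambda>h. p * (N x \<bullet> h) - p * (h \<bullet> y))) (at x)"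
    by (auto intro!: derivative_eq_intros F_has_derivative[OF x0])
  then have "(\<lambda>h. p * (N x \<bullet> h) - p * (h \<bullet> y)) = (\<lambda>h. 0)"
    by (rule has_derivative_local_min) (intro always_eventually allI min)
  then have "p * (N x \<bullet> (N x - y)) - p * ((N x - y) \<bullet> y) = 0" by meson
  then have "(N x - y) \<bullet> (N x - y) = 0"
    using p_gt_1 by (simp add: inner_diff_left inner_diff_right inner_commute right_diff_distrib[symmetric])
  then show ?thesis by simp
qed

lemma F_continuous: "continuous_on (- {0}) F"
proof (rule continuous_at_imp_continuous_on, rule ballI)
  fix x :: 'a assume "x \<in> - {0}"
  then show "continuous (at x) F"
    using has_derivative_continuous[OF F_has_derivative[of x]] by simp
qed

lemma H_continuous: "continuous_on (- {0}) H"
  unfolding H_def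
proof (rule continuous_on_powr)
  show "\<forall>x\<in>- {0}. F x \<noteq> 0" using F_pos by force
qed (intro F_continuous continuous_on_const)+

lemma H_has_derivative:
  assumes "H x = 1"
  shows "(H has_derivative (\<lambda>h. N x \<bullet> h)) (at x)"
proof -
  have Fx: "F x = 1" using assms by (simp add: H_eq_1_iff)
  have "((\<lambda>t. t powr (1 / p)) has_real_derivative 1 / p) (at (F x))"
    using Fx by (auto intro!: derivative_eq_intros)
  then have "((\<lambda>t. t powr (1 / p)) has_derivative (\<lambda>s. 1 / p * s)) (at (F x))"
    unfolding has_field_derivative_def .
  from has_derivative_compose[OF F_has_derivative[OF nonzero_if_H_eq_1[OF assms]] this]
  show ?thesis using p_gt_1 by (simp add: H_def[abs_def])
qed

lemma sphere_nonempty: "sphere (0::'a) 1 \<noteq> {}"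
  by (metis all_not_in_conv norm_Basis mem_sphere_0 nonempty_Basis)

lemma sphere_min:
  assumes "continuous_on (- {0}) g" and pos: "\<And>x. norm x = 1 \<Longrightarrow> 0 < g x"
  obtains m :: real where "0 < m" "\<And>x::'a. norm x = 1 \<Longrightarrow> m \<le> g x"
proof -
  have "continuous_on (sphere 0 1) g"
    by (rule continuous_on_subset[OF assms(1)]) auto
  from continuous_attains_inf[OF compact_sphere sphere_nonempty this]
  obtain x0 where "x0 \<in> sphere 0 1" "\<forall>x\<in>sphere 0 1. g x0 \<le> g x" by blast
  with pos[of x0] show ?thesis by (intro that[of "g x0"]) auto
qed

text \<open>By Cauchy-Schwarz a uniform margin over all unit directions leaves room for a ball. It
  provides interior points and, in \<open>frontier_K\<close>, shows that a boundary point must be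
  tight in some direction.\<close>

lemma ball_subset_K:
  assumes m: "\<And>x. norm x = 1 \<Longrightarrow> m \<le> H x - x \<bullet> y"
  shows "ball y m \<subseteq> K"
proof
  fix z assume z: "z \<in> ball y m"
  have "x \<bullet> z \<le> H x" for x
  proof (cases "x = 0")
    case False
    let ?u = "(1 / norm x) *\<^sub>R x"
    have u: "norm ?u = 1" using False by simp
    have "?u \<bullet> z = ?u \<bullet> y + ?u \<bullet> (z - y)" by (simp add: inner_diff_right)
    also have "?u \<bullet> (z - y) \<le> norm ?u * norm (z - y)" by (rule norm_cauchy_schwarz)
    also have "\<dots> \<le> m" using z u by (simp add: dist_norm norm_minus_commute)
    also have "?u \<bullet> y + m \<le> H ?u" using m[OF u] by simp
    finally have "?u \<bullet> z \<le> H ?u" by simp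
    then show ?thesis using False by (simp add: H_scale divide_right_mono divide_le_cancel)
  qed simp
  then show "z \<in> K" by (simp add: K_def)
qed

lemma closed_K: "closed K"
proof -
  have "K = (\<Inter>x. {y. x \<bullet> y \<le> H x})" by (auto simp: K_def)
  then show ?thesis by (simp add: closed_INT closed_halfspace_le)
qed

lemma convex_K: "convex K"
proof -
  have "K = (\<Inter>x. {y. x \<bullet> y \<le> H x})" by (auto simp: K_def)
  then show ?thesis by (simp add: convex_INT convex_halfspace_le)
qed

lemma bounded_K: "bounded K"
proof -
  have "continuous_on (sphere 0 1) H"
    by (rule continuous_on_subset[OF H_continuous]) auto
  from continuous_attains_sup[OF compact_sphere sphere_nonempty this]
  obtain x0 where x0: "\<And>x. norm x = 1 \<Longrightarrow> H x \<le> H x0" by (auto simp del: mem_sphere) (metis mem_sphere_0)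
  have "norm y \<le> H x0" if "y \<in> K" for y
  proof (cases "y = 0")
    case True
    then show ?thesis by (simp add: H_nonneg)
  next
    case False
    have "((1 / norm y) *\<^sub>R y) \<bullet> y \<le> H ((1 / norm y) *\<^sub>R y)"
      using that by (simp only: K_def mem_Collect_eq)
    also have "\<dots> \<le> H x0" using False by (intro x0) simp
    finally show ?thesis using False by (simp add: power2_norm_eq_inner[symmetric] power2_eq_square)
  qed
  then show ?thesis by (auto simp: bounded_iff)
qed

lemma convex_body_K: "convex_body K"
proof -
  obtain m where m: "0 < m" "\<And>x::'a. norm x = 1 \<Longrightarrow> m \<le> H x"
    using sphere_min[OF H_continuous] H_pos by (metis norm_zero zero_neq_one)
  have "ball 0 m \<subseteq> K" using m by (intro ball_subset_K) auto
  then have "ball 0 m \<subseteq> interior K" by (rule interior_maximal) simp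
  moreover have "ball (0::'a) m \<noteq> {}" using m(1) by simp
  ultimately have "interior K \<noteq> {}" by blast
  then show ?thesis
    using closed_K bounded_K convex_K by (simp add: convex_body_def compact_eq_bounded_closed)
qed

lemma centrally_symmetric_K: "centrally_symmetric K"
proof -
  have minus: "H (- x) = H x" for x using H_scale[of "-1" x] by simp
  have "- y \<in> K" if "y \<in> K" for y
    unfolding K_def
  proof (rule CollectI, rule allI)
    fix x
    have "(- x) \<bullet> y \<le> H (- x)" using that unfolding K_def by blast
    then show "x \<bullet> (- y) \<le> H x" by (simp add: minus)
  qed
  then show ?thesis
    unfolding centrally_symmetric_def by (auto intro: image_eqI[where x = "- _"])
qed

text \<open>For \<open>x \<noteq> 0\<close> the maximum is attained at \<open>N\<close> of the
  positive multiple of \<open>x\<close> on the level set \<open>H = 1\<close>.\<close>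

lemma support_function_K: "support_function K = H"
proof
  fix x
  show "support_function K x = H x"
    unfolding support_function_def
  proof (rule cSup_eq_maximum)
    show "t \<le> H x" if "t \<in> (\<lambda>y. x \<bullet> y) ` K" for t
      using that by (auto simp: K_def)
    show "H x \<in> (\<lambda>y. x \<bullet> y) ` K"
    proof (cases "x = 0")
      case True
      have "interior K \<noteq> {}" using convex_body_K by (simp add: convex_body_def)
      then obtain y where "y \<in> K" using interior_subset by blast
      with True show ?thesis by force
    next
      case False
      have "((1 / H x) *\<^sub>R x) \<bullet> N ((1 / H x) *\<^sub>R x) = 1"
        by (intro inner_N_self_eq_1 H_normalize False)
      then have "x \<bullet> N ((1 / H x) *\<^sub>R x) = H x" using H_pos[OF False] by (simp add: field_simps)
      then show ?thesis using N_in_K[OF H_normalize[OF False]] by (metis image_eqI)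
    qed
  qed
qed

text \<open>If a point of \<open>K\<close> were slack in every direction, compactness of the sphere
  would give a uniform margin and a ball inside \<open>K\<close>; a tight direction determines the
  point by \<open>eq_N_if_inner_eq_1\<close>. Conversely, moving \<open>N x\<close> along
  \<open>x\<close> violates its half-space.\<close>

lemma frontier_K: "frontier K = N ` {x. H x = 1}"
proof (intro equalityI subsetI)
  fix y assume y: "y \<in> frontier K"
  then have yK: "y \<in> K" using closed_K by (auto simp: frontier_def)
  have "\<exists>x. norm x = 1 \<and> \<not> 0 < H x - x \<bullet> y"
  proof (rule ccontr)
    assume "\<nexists>x. norm x = 1 \<and> \<not> 0 < H x - x \<bullet> y"
    moreover have "continuous_on (- {0}) (\<lambda>x. H x - x \<bullet> y)"
      by (intro continuous_intros H_continuous)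
    ultimately obtain m where m: "0 < m" "\<And>x::'a. norm x = 1 \<Longrightarrow> m \<le> H x - x \<bullet> y"
      using sphere_min[of "\<lambda>x. H x - x \<bullet> y"] by metis
    then have "ball y m \<subseteq> interior K"
      by (intro interior_maximal ball_subset_K) auto
    then have "y \<in> interior K" using m(1) by auto
    then show False using y by (simp add: frontier_def)
  qed
  then obtain x where x: "norm x = 1" "H x \<le> x \<bullet> y" by force
  have x0: "x \<noteq> 0" using x(1) by auto
  have "x \<bullet> y = H x" using x(2) yK by (simp add: K_def antisym)
  then have "((1 / H x) *\<^sub>R x) \<bullet> y = 1" using H_pos[OF x0] by simp
  from eq_N_if_inner_eq_1[OF H_normalize[OF x0] yK this]
  show "y \<in> N ` {x. H x = 1}" using H_normalize[OF x0] by blast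
next
  fix y assume "y \<in> N ` {x. H x = 1}"
  then obtain x where x: "H x = 1" "y = N x" by blast
  have x0: "x \<noteq> 0" using nonzero_if_H_eq_1[OF x(1)] .
  have "y \<notin> interior K"
  proof
    assume "y \<in> interior K"
    then obtain d where d: "0 < d" "cball y d \<subseteq> K"
      by (metis mem_interior_cball)
    have "y + (d / norm x) *\<^sub>R x \<in> cball y d" using d(1) x0 by (simp add: dist_norm)
    then have "x \<bullet> (y + (d / norm x) *\<^sub>R x) \<le> H x" using d(2) by (auto simp: K_def)
    then have "d / norm x * (x \<bullet> x) \<le> 0"
      using x by (simp add: inner_add_right inner_N_self_eq_1)
    moreover have "0 < d / norm x * (x \<bullet> x)" using d(1) x0 by simp
    ultimately show False by simp
  qed
  then show "y \<in> frontier K" using N_in_K[OF x(1)] x closed_K by (simp add: frontier_def)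
qed

text \<open>Uniqueness: a unit normal \<open>u\<close> at \<open>N x\<close> makes
  \<open>N x\<close> maximal in direction \<open>u\<close>, so \<open>N x = N ?u\<close> for the
  normalized \<open>u\<close>, and injectivity of \<open>N\<close> gives
  \<open>x = ?u\<close>.\<close>

lemma outer_normal_K:
  assumes x: "H x = 1"
  shows "outer_normal K (N x) = sgn x"
  unfolding outer_normal_def
proof (rule the_equality)
  have x0: "x \<noteq> 0" using nonzero_if_H_eq_1[OF x] .
  show "norm (sgn x) = 1 \<and> (\<forall>y\<in>K. sgn x \<bullet> (y - N x) \<le> 0)"
  proof (intro conjI ballI)
    fix y assume "y \<in> K"
    then have "x \<bullet> (y - N x) \<le> 0" using x by (simp add: K_def inner_diff_right inner_N_self_eq_1) metis
    then show "sgn x \<bullet> (y - N x) \<le> 0"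
      by (simp add: sgn_div_norm mult_nonneg_nonpos)
  qed (simp add: norm_sgn x0)
  fix u :: 'a assume u: "norm u = 1 \<and> (\<forall>y\<in>K. u \<bullet> (y - N x) \<le> 0)"
  then have u0: "u \<noteq> 0" by auto
  let ?u = "(1 / H u) *\<^sub>R u"
  have "u \<bullet> N ?u \<le> u \<bullet> N x"
    using u N_in_K[OF H_normalize[OF u0]] by (simp add: inner_diff_right)
  moreover have "u \<bullet> N ?u = H u"
    using inner_N_self_eq_1[OF H_normalize[OF u0]] H_pos[OF u0] by (simp add: field_simps)
  moreover have "u \<bullet> N x \<le> H u" using N_in_K[OF x] by (simp add: K_def)
  ultimately have "?u \<bullet> N x = 1" using H_pos[OF u0] by simp
  from eq_N_if_inner_eq_1[OF H_normalize[OF u0] N_in_K[OF x] this]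
  have "x = ?u" by (rule N_inj)
  then have "sgn x = sgn u" using H_pos[OF u0] by (simp add: sgn_scaleR)
  then show "u = sgn x" using u by (simp add: sgn_div_norm)
qed

section \<open>Curvature of the boundary\<close>

definition T :: "'a \<Rightarrow> 'a" where
  "T = inv_into (- {0}) N"

lemma N_inj_on: "inj_on N S"
  using N_inj by (auto intro: inj_onI)

lemma T_N: "x \<noteq> 0 \<Longrightarrow> T (N x) = x"
  unfolding T_def by (rule inv_into_f_f[OF N_inj_on]) simp

lemma T_nonzero: "y \<in> N ` (- {0}) \<Longrightarrow> T y \<noteq> 0"
  unfolding T_def using inv_into_into[of y N "- {0}"] by simp

lemma open_range_N: "open (N ` (- {0}))"
  by (rule invariance_of_domain[OF N_continuous _ N_inj_on]) (simp add: open_Compl)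

lemma bij_A:
  assumes "x \<noteq> 0"
  shows "bij (A x)"
proof -
  have "inj (A x)"
    unfolding linear_injective_0[OF linear_A[OF assms]] using A_pos[OF assms] by fastforce
  then show ?thesis
    using linear_injective_imp_surjective[OF linear_A[OF assms]] by (simp add: bij_def)
qed

lemma linear_inv_A: "x \<noteq> 0 \<Longrightarrow> linear (inv (A x))"
  by (intro inj_linear_imp_inv_linear linear_A bij_is_inj bij_A)

lemma A_inv_A: "x \<noteq> 0 \<Longrightarrow> A x (inv (A x) v) = v"
  using bij_A[of x] by (simp add: bij_is_surj surj_f_inv_f)

lemma inv_A_A: "x \<noteq> 0 \<Longrightarrow> inv (A x) (A x v) = v"
  using bij_A[of x] by (simp add: bij_is_inj)

lemma T_has_derivative:
  assumes x: "x \<noteq> 0"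
  shows "(T has_derivative inv (A x)) (at (N x))"
proof (rule has_derivative_inverse_strong[OF _ _ N_continuous])
  show "A x \<circ> inv (A x) = id" using A_inv_A[OF x] by auto
qed (use x T_N N_has_derivative in \<open>auto simp: open_Compl\<close>)

lemma T_continuous: "continuous_on (N ` (- {0})) T"
proof (rule continuous_at_imp_continuous_on, rule ballI)
  fix y assume "y \<in> N ` (- {0})"
  then show "continuous (at y) T"
    using has_derivative_continuous[OF T_has_derivative] by blast
qed

text \<open>Operator-valued form, because \<open>C2_on\<close> asks for a second derivative that is
  continuous in the operator norm.\<close>

definition blin_A :: "'a \<Rightarrow> 'a \<Rightarrow>\<^sub>L 'a" where
  "blin_A x = Blinfun (A x)"

definition blin_inv_A :: "'a \<Rightarrow> 'a \<Rightarrow>\<^sub>L 'a" where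
  "blin_inv_A x = Blinfun (inv (A x))"

lemma blin_A: "x \<noteq> 0 \<Longrightarrow> blinfun_apply (blin_A x) = A x"
  unfolding blin_A_def
  by (intro bounded_linear_Blinfun_apply) (simp add: linear_A linear_conv_bounded_linear[symmetric])

lemma blin_inv_A: "x \<noteq> 0 \<Longrightarrow> blinfun_apply (blin_inv_A x) = inv (A x)"
  unfolding blin_inv_A_def
  by (intro bounded_linear_Blinfun_apply) (simp add: linear_inv_A linear_conv_bounded_linear[symmetric])

lemma blin_A_continuous: "continuous_on (- {0}) blin_A"
proof (rule continuous_on_blinfun_componentwise)
  fix i :: 'a
  show "continuous_on (- {0}) (\<lambda>x. blinfun_apply (blin_A x) i)"
    by (rule continuous_on_eq[OF A_continuous[of i]]) (simp add: blin_A)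
qed

lemma blin_inv_A_continuous: "continuous_on (- {0}) blin_inv_A"
  unfolding continuous_on_def
proof
  fix x :: 'a assume x: "x \<in> - {0}"
  show "(blin_inv_A \<longlongrightarrow> blin_inv_A x) (at x within - {0})"
  proof (rule blinfun_inverse_tendsto)
    show "(blin_A \<longlongrightarrow> blin_A x) (at x within - {0})"
      using blin_A_continuous x by (simp add: continuous_on_def)
    show "blin_A x o\<^sub>L blin_inv_A x = id_blinfun"
      using x by (intro blinfun_eqI) (simp add: blin_A blin_inv_A A_inv_A)
    show "\<forall>\<^sub>F z in at x within - {0}. blin_inv_A z o\<^sub>L blin_A z = id_blinfun"
      unfolding eventually_at_filter
      by (intro always_eventually allI impI blinfun_eqI) (simp add: blin_A blin_inv_A inv_A_A)
  qed
qed

text \<open>Up to a constant, the convex conjugate of \<open>\<lambda>x. F x / p\<close>, with gradient \<open>T\<close>.\<close>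

definition conj_F :: "'a \<Rightarrow> real" where
  "conj_F y = y \<bullet> T y - F (T y) / p - (1 - 1 / p)"

text \<open>Legendre duality: the terms containing the derivative of \<open>T\<close> cancel because
  \<open>N (T y) = y\<close>.\<close>

lemma conj_F_has_derivative:
  assumes y: "y \<in> N ` (- {0})"
  shows "(conj_F has_derivative (\<lambda>h. T y \<bullet> h)) (at y)"
proof -
  obtain x where x: "x \<noteq> 0" "y = N x" using y by blast
  have Ty: "T y = x" using x T_N by simp
  note T = T_has_derivative[OF x(1), folded x(2)]
  have "((\<lambda>y. F (T y)) has_derivative (\<lambda>h. p * (N x \<bullet> inv (A x) h))) (at y)"
    using has_derivative_compose[OF T] F_has_derivative[OF x(1)] by (simp add: Ty)
  then have "(conj_F has_derivative
      (\<lambda>h. (y \<bullet> inv (A x) h + h \<bullet> T y) - p * (N x \<bullet> inv (A x) h) / p - 0)) (at y)"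
    unfolding conj_F_def[abs_def]
    by (intro has_derivative_diff has_derivative_inner has_derivative_ident T
        has_derivative_const has_derivative_divide' bounded_linear.has_derivative[OF bounded_linear_divide])
  then show ?thesis using p_gt_1 x by (simp add: inner_commute)
qed

lemma C2_on_conj_F: "C2_on (N ` (- {0})) conj_F"
  unfolding C2_on_def
proof (intro exI conjI ballI)
  let ?U = "N ` (- {0})"
  let ?g' = "\<lambda>y. blinfun_inner_right (T y)"
  let ?g'' = "\<lambda>y. Blinfun blinfun_inner_right o\<^sub>L blin_inv_A (T y)"
  show "(conj_F has_derivative blinfun_apply (?g' y)) (at y)" if "y \<in> ?U" for y
    using conj_F_has_derivative[OF that] by simp
  show "(?g' has_derivative blinfun_apply (?g'' y)) (at y)" if y: "y \<in> ?U" for y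
  proof -
    obtain x where x: "x \<noteq> 0" "y = N x" using y by auto
    have "(?g' has_derivative (\<lambda>h. blinfun_inner_right (inv (A x) h))) (at y)"
      using T_has_derivative[OF x(1)] x(2)
      by (intro bounded_linear.has_derivative[OF bounded_linear_blinfun_inner_right]) simp
    then show ?thesis
      using x by (simp add: T_N o_def blinfun_compose.rep_eq blin_inv_A
          bounded_linear_Blinfun_apply[OF bounded_linear_blinfun_inner_right])
  qed
  have "continuous_on ?U (\<lambda>y. blin_inv_A (T y))"
  proof (rule continuous_on_compose2[OF blin_inv_A_continuous T_continuous])
    show "T ` ?U \<subseteq> - {0}" by (rule image_subsetI) (simp add: T_nonzero)
  qed
  then show "continuous_on ?U ?g''" by (intro continuous_intros)
qed

lemma C2_hypersurface_frontier_K: "C2_hypersurface (frontier K)"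
  unfolding C2_hypersurface_def
proof (intro ballI exI conjI)
  let ?U = "N ` (- {0})"
  show "open ?U" by (rule open_range_N)
  show "C2_on ?U conj_F" by (rule C2_on_conj_F)
  show "y \<in> ?U" if "y \<in> frontier K" for y
    using that nonzero_if_H_eq_1 unfolding frontier_K by auto
  show "\<not> (conj_F has_derivative (\<lambda>_. 0)) (at y)" if y: "y \<in> frontier K \<inter> ?U" for y
  proof
    assume "(conj_F has_derivative (\<lambda>_. 0)) (at y)"
    then have "(\<lambda>h. T y \<bullet> h) = (\<lambda>_. 0)"
      using conj_F_has_derivative[of y] y has_derivative_unique by blast
    then have "T y \<bullet> T y = 0" by meson
    then show False using y T_nonzero[of y] by simp
  qed
  have "conj_F (N x) = 0 \<longleftrightarrow> H x = 1" if "x \<noteq> 0" for x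
  proof -
    \<comment> \<open>Euler's relation turns \<open>x \<bullet> N x\<close> into \<open>F x\<close>;
      the constant in \<open>conj_F\<close> is chosen so that the level set \<open>F x = 1\<close>
      has value 0.\<close>
    have "conj_F (N x) = (F x - 1) * (1 - 1 / p)"
      using that by (simp add: conj_F_def T_N N_inner_self algebra_simps)
    then show ?thesis using p_gt_1 by (simp add: H_eq_1_iff)
  qed
  then show "frontier K \<inter> ?U = {y \<in> ?U. conj_F y = 0}"
    using nonzero_if_H_eq_1 unfolding frontier_K by auto
qed

section \<open>Gauss map and Weingarten map\<close>

lemma frontier_KE:
  assumes "y \<in> frontier K"
  obtains x where "H x = 1" "y = N x"
  using assms unfolding frontier_K by blast

text \<open>On the boundary the normal equals \<open>sgn (T y)\<close>, which is differentiable at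
  \<open>N x\<close>. The explicit derivative only proves differentiability:
  \<open>weingarten_map\<close> may be another derivative within the boundary.\<close>

lemma outer_normal_has_derivative:
  assumes x: "H x = 1"
  shows "(outer_normal K has_derivative weingarten_map K (N x)) (at (N x) within frontier K)"
proof -
  have x0: "x \<noteq> 0" using nonzero_if_H_eq_1[OF x] .
  have "((\<lambda>y. sgn (T y)) has_derivative
      (\<lambda>h. inv (A x) h /\<^sub>R norm x - ((inv (A x) h \<bullet> sgn x) / (norm x)\<^sup>2) *\<^sub>R x)) (at (N x))"
    using has_derivative_compose[OF T_has_derivative[OF x0]] has_derivative_sgn[OF x0] x0
    by (simp add: T_N)
  from has_derivative_at_withinI[OF this, of "frontier K"]
  have "(outer_normal K has_derivative
      (\<lambda>h. inv (A x) h /\<^sub>R norm x - ((inv (A x) h \<bullet> sgn x) / (norm x)\<^sup>2) *\<^sub>R x))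
      (at (N x) within frontier K)"
  proof (rule has_derivative_transform[rotated 2])
    show "N x \<in> frontier K" using x by (simp add: frontier_K)
    fix y assume "y \<in> frontier K"
    then show "outer_normal K y = sgn (T y)"
      by (elim frontier_KE) (simp add: outer_normal_K T_N nonzero_if_H_eq_1)
  qed
  then show ?thesis
    unfolding weingarten_map_def frechet_derivative_works[symmetric]
    by (rule differentiableI)
qed

text \<open>The vector \<open>v\<close> is the velocity at time \<open>0\<close> of the curve \<open>N ((x + t w) / H (x + t w))\<close> in
  the boundary, where \<open>w = inv (A x) v\<close>.\<close>

lemma weingarten_map_K:
  assumes x: "H x = 1" and v: "x \<bullet> v = 0"
  defines "w \<equiv> inv (A x) v"
  shows "weingarten_map K (N x) v = w /\<^sub>R norm x - ((w \<bullet> sgn x) / (norm x)\<^sup>2) *\<^sub>R x"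
proof -
  have x0: "x \<noteq> 0" using nonzero_if_H_eq_1[OF x] .
  have Aw: "A x w = v" unfolding w_def by (rule A_inv_A[OF x0])
  \<comment> \<open>So \<open>w\<close> is tangent to the level set of \<open>H\<close>. Hence the
    line \<open>x + t w\<close> avoids 0 and normalizing it by \<open>H\<close> does not change its
    velocity at 0.\<close>
  have Nw: "N x \<bullet> w = 0"
  proof -
    have "(p - 1) * (N x \<bullet> w) = A x x \<bullet> w" by (simp add: A_self)
    also have "\<dots> = 0" using A_sym[OF x0, of x w] v by (simp add: Aw)
    finally show ?thesis using p_gt_1 by simp
  qed
  have nz: "x + t *\<^sub>R w \<noteq> 0" for t
  proof
    assume "x + t *\<^sub>R w = 0"
    then have "N x \<bullet> (x + t *\<^sub>R w) = 0" by simp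
    then show False using F_pos[OF x0] Nw by (simp add: inner_add_right N_inner_self)
  qed
  define c where "c t = N ((1 / H (x + t *\<^sub>R w)) *\<^sub>R (x + t *\<^sub>R w))" for t
  have c: "c t \<in> frontier K" "outer_normal K (c t) = sgn (x + t *\<^sub>R w)" for t
    using H_normalize[OF nz[of t]] H_pos[OF nz[of t]]
    by (auto simp: c_def frontier_K outer_normal_K sgn_scaleR)
  have line: "((\<lambda>t. x + t *\<^sub>R w) has_derivative (\<lambda>t. t *\<^sub>R w)) (at 0)"
    by (auto intro!: derivative_eq_intros)
  have "((\<lambda>t. H (x + t *\<^sub>R w)) has_derivative (\<lambda>t. N x \<bullet> (t *\<^sub>R w))) (at 0)"
    using has_derivative_compose[OF line, of H "\<lambda>h. N x \<bullet> h"] H_has_derivative[OF x] by simp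
  then have "((\<lambda>t. H (x + t *\<^sub>R w)) has_derivative (\<lambda>t. 0)) (at 0)"
    by (simp add: Nw)
  then have "((\<lambda>t. (1 / H (x + t *\<^sub>R w)) *\<^sub>R (x + t *\<^sub>R w)) has_derivative (\<lambda>t. t *\<^sub>R w)) (at 0)"
    using x line by (auto intro!: derivative_eq_intros)
  from has_derivative_compose[OF this, of N "A x"] N_has_derivative[OF x0]
  have "(c has_derivative (\<lambda>t. A x (t *\<^sub>R w))) (at 0)"
    using x by (simp add: c_def[abs_def])
  then have c': "(c has_derivative (\<lambda>t. t *\<^sub>R v)) (at 0)"
    using linear_cmul[OF linear_A[OF x0]] by (simp add: Aw)
  have "c 0 = N x" using x by (simp add: c_def)
  then have "(outer_normal K has_derivative weingarten_map K (N x)) (at (c 0) within range c)"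
    using has_derivative_subset[OF outer_normal_has_derivative[OF x], of "range c"] c(1) by auto
  \<comment> \<open>The normal along the curve is differentiated twice, by the chain rule through
    the boundary and directly as \<open>sgn (x + t w)\<close>. Uniqueness of derivatives on the real
    line identifies the results.\<close>
  from has_derivative_in_compose[OF c' this]
  have "((\<lambda>t. sgn (x + t *\<^sub>R w)) has_derivative (\<lambda>t. weingarten_map K (N x) (t *\<^sub>R v))) (at 0)"
    by (simp add: c(2))
  moreover have "(sgn has_derivative (\<lambda>h. h /\<^sub>R norm x - ((h \<bullet> sgn x) / (norm x)\<^sup>2) *\<^sub>R x)) (at (x + 0 *\<^sub>R w))"
    using has_derivative_sgn[OF x0] by simp
  from has_derivative_compose[OF line this]
  have "((\<lambda>t. sgn (x + t *\<^sub>R w)) has_derivative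
      (\<lambda>t. (t *\<^sub>R w) /\<^sub>R norm x - ((t *\<^sub>R w \<bullet> sgn x) / (norm x)\<^sup>2) *\<^sub>R x)) (at 0)" .
  ultimately have "(\<lambda>t. weingarten_map K (N x) (t *\<^sub>R v))
      = (\<lambda>t. (t *\<^sub>R w) /\<^sub>R norm x - ((t *\<^sub>R w \<bullet> sgn x) / (norm x)\<^sup>2) *\<^sub>R x)"
    by (rule has_derivative_unique)
  from fun_cong[OF this, of 1] show ?thesis by simp
qed

text \<open>Pairing the eigenvalue equation with \<open>v\<close> removes the component along
  \<open>x\<close> and leaves
  \<open>\<kappa> * (v \<bullet> v) = (w \<bullet> A x w) / norm x\<close>.\<close>

lemma principal_curvature_pos:
  assumes y: "y \<in> frontier K" and k: "\<kappa> \<in> principal_curvatures K y"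
  shows "0 < \<kappa>"
proof -
  obtain x where x: "H x = 1" "y = N x" using y by (rule frontier_KE)
  have x0: "x \<noteq> 0" using nonzero_if_H_eq_1[OF x(1)] .
  obtain v where v: "v \<noteq> 0" "sgn x \<bullet> v = 0" "weingarten_map K y v = \<kappa> *\<^sub>R v"
    using k x by (auto simp: principal_curvatures_def principal_directions_def tangent_space_def outer_normal_K)
  have xv: "x \<bullet> v = 0" using v(2) x0 by (simp add: sgn_div_norm)
  define w where "w = inv (A x) v"
  have Aw: "A x w = v" unfolding w_def by (rule A_inv_A[OF x0])
  have "w \<noteq> 0" using Aw v(1) linear_0[OF linear_A[OF x0]] by auto
  have "\<kappa> * (v \<bullet> v) = (\<kappa> *\<^sub>R v) \<bullet> v" by simp
  also have "\<dots> = (w \<bullet> v) / norm x"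
    unfolding v(3)[symmetric] x(2) weingarten_map_K[OF x(1) xv, folded w_def]
    using xv by (simp add: inner_diff_left divide_inverse mult.commute)
  also have "\<dots> > 0"
    using A_pos[OF x0 \<open>w \<noteq> 0\<close>] x0 by (simp add: Aw inner_commute)
  finally show ?thesis by (rule zero_less_mult_pos2) (simp add: v(1))
qed

lemma positive_gauss_kronecker_curvature_K: "positive_gauss_kronecker_curvature K"
  unfolding positive_gauss_kronecker_curvature_def gauss_kronecker_curvature_def
  using C2_hypersurface_frontier_K
  by (intro conjI ballI prod_pos zero_less_power principal_curvature_pos)

end

section \<open>The spherical measure\<close>

lemma measurable_sgn_cball:
  "sgn \<in> restrict_space lborel (cball 0 1 - {0::'a::euclidean_space})
    \<rightarrow>\<^sub>M restrict_space borel (sphere 0 1)"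
proof (rule measurable_restrict_space2)
  have "sgn \<in> borel_measurable (borel :: 'a measure)"
    unfolding sgn_div_norm [abs_def] by measurable
  then show "sgn \<in> borel_measurable (restrict_space lborel (cball 0 1 - {0::'a}))"
    by (intro measurable_restrict_space1) simp
qed (auto simp: space_restrict_space norm_sgn)

lemma sets_sphere_borel: "sets sphere_borel = sets (restrict_space borel (sphere 0 1))"
  by (simp add: sphere_borel_def)

lemma space_sphere_borel: "space sphere_borel = sphere 0 1"
  using sets_eq_imp_space_eq[OF sets_sphere_borel] by (simp add: space_restrict_space)

lemma measurable_ident_sphere_borel: "(\<lambda>\<xi>. \<xi>) \<in> sphere_borel \<rightarrow>\<^sub>M borel"
  unfolding measurable_cong_sets[OF sets_sphere_borel refl]
  by (rule measurable_restrict_space1) simp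

lemma nn_integral_sphere_borel:
  fixes k :: "'a::euclidean_space \<Rightarrow> ennreal"
  assumes "k \<in> borel_measurable sphere_borel"
  shows "(\<integral>\<^sup>+ \<xi>. k \<xi> \<partial>sphere_borel)
    = ennreal (real DIM('a)) * (\<integral>\<^sup>+ y. k (sgn y) * indicator (cball 0 1 - {0}) y \<partial>lborel)"
proof -
  have k: "k \<in> borel_measurable (restrict_space borel (sphere 0 1))"
    using assms unfolding measurable_cong_sets[OF sets_sphere_borel refl] .
  show ?thesis
    unfolding sphere_borel_def using k
    by (subst nn_integral_scale_measure)
      (simp_all add: nn_integral_distr[OF measurable_sgn_cball] nn_integral_restrict_space)
qed

text \<open>In polar coordinates, moving from \<open>sgn y\<close> to a point \<open>y\<close> of
  the ball shrinks \<open>\<bar>x \<bullet> y\<bar>\<close>, so the monotone \<open>h\<close> can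
  only grow and the ball estimate applies.\<close>

lemma nn_integral_sphere_borel_inner_le:
  fixes x :: "'a::euclidean_space" and h :: "real \<Rightarrow> ennreal"
  assumes x: "x \<noteq> 0" and h [measurable]: "h \<in> borel_measurable borel"
    and anti: "\<And>a b. 0 < \<bar>a\<bar> \<Longrightarrow> \<bar>a\<bar> \<le> \<bar>b\<bar> \<Longrightarrow> h b \<le> h a"
  shows "(\<integral>\<^sup>+ \<xi>. h (x \<bullet> \<xi>) \<partial>sphere_borel)
    \<le> ennreal (real DIM('a) * measure lborel (cball 0 2 :: 'a set) / norm x) * (\<integral>\<^sup>+ s. h s \<partial>lborel)"
proof -
  note measurable_ident_sphere_borel [measurable]
  have "(\<integral>\<^sup>+ \<xi>. h (x \<bullet> \<xi>) \<partial>sphere_borel)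
      = ennreal (real DIM('a)) * (\<integral>\<^sup>+ y. h (x \<bullet> sgn y) * indicator (cball 0 1 - {0}) y \<partial>lborel)"
    by (rule nn_integral_sphere_borel) measurable
  also have "(\<integral>\<^sup>+ y. h (x \<bullet> sgn y) * indicator (cball 0 1 - {0}) y \<partial>lborel)
      \<le> (\<integral>\<^sup>+ y. h (x \<bullet> y) * indicator (cball 0 1) y \<partial>lborel)"
  proof (rule nn_integral_mono)
    fix y :: 'a
    \<comment> \<open>When \<open>x \<bullet> y = 0\<close> both arguments are 0, a value about
      which \<open>anti\<close> says nothing.\<close>
    have "h (x \<bullet> sgn y) \<le> h (x \<bullet> y)" if y: "norm y \<le> 1" "y \<noteq> 0"
    proof (cases "x \<bullet> y = 0")
      case False
      have "\<bar>x \<bullet> y\<bar> \<le> \<bar>x \<bullet> y\<bar> / norm y"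
        using y by (simp add: le_divide_eq mult_left_le)
      then show ?thesis
        using False by (intro anti) (auto simp: sgn_div_norm divide_inverse abs_mult mult.commute)
    qed (simp add: sgn_div_norm)
    then show "h (x \<bullet> sgn y) * indicator (cball 0 1 - {0}) y \<le> h (x \<bullet> y) * indicator (cball 0 1) y"
      by (auto split: split_indicator)
  qed
  also have "\<dots> \<le> emeasure lborel (cball 0 2 :: 'a set) * (ennreal (1 / norm x) * (\<integral>\<^sup>+ s. h s \<partial>lborel))"
    by (rule nn_integral_ball_inner_le[OF x h])
  also have "emeasure lborel (cball 0 2 :: 'a set) = ennreal (measure lborel (cball 0 2 :: 'a set))"
    using emeasure_lborel_cball_finite[of "0::'a" 2] by (intro emeasure_eq_ennreal_measure) simp
  finally show ?thesis
    by (simp add: mult_left_mono mult.assoc[symmetric] ennreal_mult'[symmetric])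
qed

text \<open>Pushed forward to the Borel sets of the whole space, the form that
  \<open>powr_transform\<close> expects.\<close>

definition weighted_sphere :: "('a::euclidean_space \<Rightarrow> real) \<Rightarrow> 'a measure" where
  "weighted_sphere g = distr (density sphere_borel (\<lambda>\<xi>. ennreal (g \<xi>))) borel (\<lambda>\<xi>. \<xi>)"

lemma measurable_ident_density_sphere:
  "(\<lambda>\<xi>. \<xi>) \<in> density sphere_borel w \<rightarrow>\<^sub>M borel"
  using measurable_ident_sphere_borel by simp

lemma nn_integral_weighted_sphere:
  fixes k :: "'a::euclidean_space \<Rightarrow> ennreal"
  assumes [measurable]: "g \<in> borel_measurable sphere_borel" "k \<in> borel_measurable borel"
  shows "(\<integral>\<^sup>+ y. k y \<partial>weighted_sphere g) = (\<integral>\<^sup>+ \<xi>. ennreal (g \<xi>) * k \<xi> \<partial>sphere_borel)"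
proof -
  have k: "k \<in> borel_measurable sphere_borel"
    using measurable_compose[OF measurable_ident_sphere_borel] assms(2) by blast
  have "(\<integral>\<^sup>+ y. k y \<partial>weighted_sphere g) = (\<integral>\<^sup>+ \<xi>. k \<xi> \<partial>density sphere_borel (\<lambda>\<xi>. ennreal (g \<xi>)))"
    unfolding weighted_sphere_def
    by (rule nn_integral_distr[OF measurable_ident_density_sphere]) simp
  also have "\<dots> = (\<integral>\<^sup>+ \<xi>. ennreal (g \<xi>) * k \<xi> \<partial>sphere_borel)"
    by (rule nn_integral_density[OF _ k]) measurable
  finally show ?thesis .
qed

lemma integral_weighted_sphere:
  fixes k :: "'a::euclidean_space \<Rightarrow> real"
  assumes [measurable]: "g \<in> borel_measurable sphere_borel" "k \<in> borel_measurable borel"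
    and "\<And>\<xi>. 0 \<le> g \<xi>"
  shows "(LINT y|weighted_sphere g. k y) = (LINT \<xi>|sphere_borel. g \<xi> * k \<xi>)"
proof -
  have k: "k \<in> borel_measurable sphere_borel"
    using measurable_compose[OF measurable_ident_sphere_borel] assms(2) by blast
  have "(LINT y|weighted_sphere g. k y) = (LINT \<xi>|density sphere_borel (\<lambda>\<xi>. ennreal (g \<xi>)). k \<xi>)"
    unfolding weighted_sphere_def
    by (rule integral_distr[OF measurable_ident_density_sphere]) simp
  also have "\<dots> = (LINT \<xi>|sphere_borel. g \<xi> * k \<xi>)"
    using k assms by (subst integral_density) auto
  finally show ?thesis .
qed

text \<open>The slab constant is the bound on the density times the constant of
  \<open>nn_integral_sphere_borel_inner_le\<close>.\<close>

lemma powr_transform_weighted_sphere: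
  fixes g :: "'a::euclidean_space \<Rightarrow> real"
  assumes p: "p > 1" and g [measurable]: "g \<in> borel_measurable sphere_borel"
    and g_nonneg: "\<And>\<xi>. 0 \<le> g \<xi>" and g_le: "\<And>\<xi>. g \<xi> \<le> B"
    and nonzero: "\<not> (AE \<xi> in sphere_borel. g \<xi> = 0)"
  shows "powr_transform (weighted_sphere g) p (B * (real DIM('a) * measure lborel (cball 0 2 :: 'a set)))"
proof -
  have B: "0 \<le> B" using g_nonneg g_le by (rule order.trans)
  let ?D = "real DIM('a) * measure lborel (cball 0 2 :: 'a set)"
  have sets: "sets (weighted_sphere g) = sets borel" by (simp add: weighted_sphere_def)
  have space: "space (weighted_sphere g) = UNIV" by (simp add: weighted_sphere_def)
  have total: "emeasure (weighted_sphere g) UNIV = (\<integral>\<^sup>+ \<xi>. ennreal (g \<xi>) \<partial>sphere_borel)"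
    using nn_integral_weighted_sphere[OF g, of "\<lambda>_. 1"] by (simp add: space)
  have le: "(\<integral>\<^sup>+ y. k y \<partial>weighted_sphere g) \<le> ennreal B * (\<integral>\<^sup>+ \<xi>. k \<xi> \<partial>sphere_borel)"
    if k: "k \<in> borel_measurable borel" for k :: "'a \<Rightarrow> ennreal"
  proof -
    have "(\<integral>\<^sup>+ y. k y \<partial>weighted_sphere g) \<le> (\<integral>\<^sup>+ \<xi>. ennreal B * k \<xi> \<partial>sphere_borel)"
      unfolding nn_integral_weighted_sphere[OF g k]
      by (intro nn_integral_mono mult_right_mono ennreal_leI g_le) simp
    also have "\<dots> = ennreal B * (\<integral>\<^sup>+ \<xi>. k \<xi> \<partial>sphere_borel)"
      using measurable_compose[OF measurable_ident_sphere_borel k] by (rule nn_integral_cmult)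
    finally show ?thesis .
  qed
  interpret finite_measure "weighted_sphere g"
  proof
    have "(\<integral>\<^sup>+ \<xi>. (1 :: ennreal) \<partial>(sphere_borel :: 'a measure))
        \<le> ennreal (real DIM('a)) * emeasure lborel (cball 0 1 :: 'a set)"
      by (subst nn_integral_sphere_borel)
        (auto intro!: mult_left_mono emeasure_mono)
    also have "\<dots> < \<infinity>"
      using emeasure_lborel_cball_finite[of "0::'a" 1] by (simp add: ennreal_mult_less_top)
    finally have "ennreal B * (\<integral>\<^sup>+ \<xi>. (1 :: ennreal) \<partial>(sphere_borel :: 'a measure)) < \<infinity>"
      by (simp add: ennreal_mult_less_top)
    with le[of "\<lambda>_. 1"] have "(\<integral>\<^sup>+ y. 1 \<partial>weighted_sphere g) < \<infinity>"
      by (rule order.strict_trans1) simp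
    then show "emeasure (weighted_sphere g) (space (weighted_sphere g)) \<noteq> \<infinity>" by simp
  qed
  show ?thesis
  proof
    show "0 \<le> B * ?D" using B by simp
    show "AE y in weighted_sphere g. norm y \<le> 1"
      unfolding weighted_sphere_def
      by (subst AE_distr_iff[OF measurable_ident_density_sphere])
        (auto simp: AE_density intro!: AE_I2 simp: space_sphere_borel)
    show "emeasure (weighted_sphere g) UNIV \<noteq> 0"
    proof -
      have "g \<xi> \<le> 0 \<longleftrightarrow> g \<xi> = 0" for \<xi> using g_nonneg[of \<xi>] by auto
      then show ?thesis using nonzero by (simp add: total nn_integral_0_iff_AE ennreal_eq_0_iff)
    qed
    fix x :: 'a and h :: "real \<Rightarrow> ennreal"
    assume x: "x \<noteq> 0" and h [measurable]: "h \<in> borel_measurable borel"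
      and anti: "\<And>a b. 0 < \<bar>a\<bar> \<Longrightarrow> \<bar>a\<bar> \<le> \<bar>b\<bar> \<Longrightarrow> h b \<le> h a"
    have "(\<integral>\<^sup>+ y. h (x \<bullet> y) \<partial>weighted_sphere g) \<le> ennreal B * (\<integral>\<^sup>+ \<xi>. h (x \<bullet> \<xi>) \<partial>sphere_borel)"
      by (rule le) measurable
    also have "\<dots> \<le> ennreal B * (ennreal (?D / norm x) * (\<integral>\<^sup>+ s. h s \<partial>lborel))"
      by (intro mult_left_mono nn_integral_sphere_borel_inner_le x h anti) auto
    also have "\<dots> = ennreal (B * ?D / norm x) * (\<integral>\<^sup>+ s. h s \<partial>lborel)"
      using B by (simp add: mult.assoc[symmetric] ennreal_mult'[symmetric])
    finally show "(\<integral>\<^sup>+ y. h (x \<bullet> y) \<partial>weighted_sphere g)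
        \<le> ennreal (B * ?D / norm x) * (\<integral>\<^sup>+ s. h s \<partial>lborel)" .
  qed (rule p sets)+
qed

text \<open>Replaces the Lebesgue measurable \<open>f\<close> by a Borel function with bounds valid
  everywhere, without changing the integrals.\<close>

lemma L_infinity_sphere_weight:
  fixes f :: "'a::euclidean_space \<Rightarrow> real"
  assumes f: "L_infinity sphere_lebesgue f" and nonneg: "AE \<xi> in sphere_lebesgue. 0 \<le> f \<xi>"
  obtains g B where "g \<in> borel_measurable sphere_borel" "\<And>\<xi>. 0 \<le> g \<xi>" "\<And>\<xi>. g \<xi> \<le> B"
    "\<And>k. k \<in> borel_measurable borel \<Longrightarrow>
      (LINT \<xi>|sphere_lebesgue. k \<xi> * f \<xi>) = (LINT \<xi>|sphere_borel. g \<xi> * k \<xi>)"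
proof -
  have f_meas: "f \<in> borel_measurable (completion sphere_borel)"
    using f by (simp add: L_infinity_def sphere_lebesgue_def)
  obtain C where C: "AE \<xi> in sphere_borel. \<bar>f \<xi>\<bar> \<le> C"
    using f by (auto simp: L_infinity_def sphere_lebesgue_def AE_completion_iff)
  obtain g0 where g0: "g0 \<in> borel_measurable sphere_borel" "AE \<xi> in sphere_borel. f \<xi> = g0 \<xi>"
    using completion_ex_borel_measurable_real[OF f_meas] by blast
  \<comment> \<open>Clamping alters the Borel version only on a null set;
    \<open>\<bar>C\<bar>\<close> ensures that the upper bound is nonnegative.\<close>
  define g where "g \<xi> = max 0 (min \<bar>C\<bar> (g0 \<xi>))" for \<xi>
  have g: "g \<in> borel_measurable sphere_borel"
    unfolding g_def using g0(1) by measurable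
  have "AE \<xi> in sphere_borel. 0 \<le> f \<xi>"
    using nonneg unfolding sphere_lebesgue_def AE_completion_iff .
  with C g0(2) have fg: "AE \<xi> in sphere_borel. f \<xi> = g \<xi>"
    by eventually_elim (auto simp: g_def)
  show thesis
  proof (rule that[OF g])
    show "0 \<le> g \<xi>" "g \<xi> \<le> \<bar>C\<bar>" for \<xi> by (auto simp: g_def)
    fix k :: "'a \<Rightarrow> real" assume "k \<in> borel_measurable borel"
    then have k: "k \<in> borel_measurable sphere_borel"
      using measurable_compose[OF measurable_ident_sphere_borel] by blast
    have gk: "(\<lambda>\<xi>. g \<xi> * k \<xi>) \<in> borel_measurable sphere_borel"
      using g k by measurable
    have "(LINT \<xi>|sphere_lebesgue. k \<xi> * f \<xi>) = (LINT \<xi>|completion sphere_borel. g \<xi> * k \<xi>)"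
      unfolding sphere_lebesgue_def
    proof (rule integral_cong_AE)
      show "AE \<xi> in completion sphere_borel. k \<xi> * f \<xi> = g \<xi> * k \<xi>"
        unfolding AE_completion_iff using fg by eventually_elim simp
    qed (use f_meas measurable_completion[OF k] measurable_completion[OF gk] in measurable)
    also have "\<dots> = (LINT \<xi>|sphere_borel. g \<xi> * k \<xi>)"
      by (rule integral_completion[OF gk])
    finally show "(LINT \<xi>|sphere_lebesgue. k \<xi> * f \<xi>) = (LINT \<xi>|sphere_borel. g \<xi> * k \<xi>)" .
  qed
qed

theorem theorem3p1:
  fixes p :: real and f H :: "real ^ 'n \<Rightarrow> real"
  assumes "CARD('n) \<ge> 2"
    and "p > 1"
    and "\<not> (\<exists>k::int. p = 2 * of_int k)"
    and "L_infinity sphere_lebesgue f"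
    and "AE \<xi> in sphere_lebesgue. 0 \<le> f \<xi>"
    and "0 < (LINT \<xi>|sphere_lebesgue. f \<xi>)"
    and "\<And>x. 0 \<le> H x"
    and "\<And>x. H x powr p = (LINT \<xi>|sphere_lebesgue. \<bar>x \<bullet> \<xi>\<bar> powr p * f \<xi>)"
  shows "\<exists>K. convex_body K \<and> centrally_symmetric K \<and>
    positive_gauss_kronecker_curvature K \<and> H = support_function K"
proof -
  obtain g B where g: "g \<in> borel_measurable sphere_borel" "\<And>\<xi>. 0 \<le> g \<xi>" "\<And>\<xi>. g \<xi> \<le> B"
    and int: "\<And>k. k \<in> borel_measurable borel \<Longrightarrow>
      (LINT \<xi>|sphere_lebesgue. k \<xi> * f \<xi>) = (LINT \<xi>|sphere_borel. g \<xi> * k \<xi>)"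
    using L_infinity_sphere_weight[OF assms(4,5)] by blast
  \<comment> \<open>Otherwise \<open>int\<close> with the constant 1 would make the integral of
    \<open>f\<close> vanish.\<close>
  have "\<not> (AE \<xi> in sphere_borel. g \<xi> = 0)"
  proof
    assume "AE \<xi> in sphere_borel. g \<xi> = 0"
    then have "(LINT \<xi>|sphere_borel. g \<xi>) = 0" by (rule integral_eq_zero_AE)
    then show False using int[of "\<lambda>_. 1"] assms(6) by simp
  qed
  then interpret S: powr_transform "weighted_sphere g" p
      "B * (real DIM(real ^ 'n) * measure lborel (cball 0 2 :: (real ^ 'n) set))"
    using assms(2) g by (intro powr_transform_weighted_sphere)
  have F: "H x powr p = S.F x" for x
  proof -
    have k: "(\<lambda>y. \<bar>x \<bullet> y\<bar> powr p) \<in> borel_measurable borel" by measurable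
    show ?thesis
      unfolding S.F_def assms(8) int[OF k] by (rule integral_weighted_sphere[OF g(1) k g(2), symmetric])
  qed
  \<comment> \<open>Being nonnegative, \<open>H\<close> is determined by its \<open>p\<close>-th
    power.\<close>
  have "H = S.H"
  proof
    fix x
    have "H x = (H x powr p) powr (1 / p)"
      using assms(2) assms(7)[of x] by (simp add: powr_powr)
    then show "H x = S.H x" by (simp add: F S.H_def)
  qed
  then show ?thesis
    using S.convex_body_K S.centrally_symmetric_K S.positive_gauss_kronecker_curvature_K
      S.support_function_K by auto
qed

end
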